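(* Let $n\geq1$, and let $p_0$ be a projection of rank $n-1$ in the partition monoid $\mathcal P_n$. Then the maximal subgroup of the free projection-generated semigroup $\mathsf{PG}(\mathsf P(\mathcal P_n))$ containing $x_{p_0}$ is free of rank $\binom{n-1}{2}$.
   Context: **Partition monoid.** $\mathcal P_n$ consists of all set partitions of $[n]\cup[n]'$, where $[n]=\{1,\dots,n\}$ and $[n]'=\{1',\dots,n'\}$. A partition is identified with any graph on $[n]\cup[n]'$ whose connected components are its blocks. To multiply $a,b\in\mathcal P_n$: let $[n]''$ be a third copy of $[n]$, rename the vertices $x'$ of $a$ to $x''$, rename the vertices $x$ of $b$ to $x''$, and take the union of the edges to obtain a graph $\Gamma(a,b)$ on $[n]\cup[n]''\cup[n]'$; then $x,y\in[n]\cup[n]'$ are in the same block of $ab$ iff they are in the same connected component of $\Gamma(a,b)$. A block meeting both $[n]$ and $[n]'$ is a transversal; the rank of $a$ is its number of transversals. The involution $a\mapsto a^*$ swaps $x\leftrightarrow x'$; it makes $\mathcal P_n$ a regular $*$-semigroup, i.e. $(a^* )^*=a=aa^*a$ and $(ab)^*=b^*a^*$. **Projections and $\mathsf{PG}(P)$.** A projection is an element $p$ with $p^2=p=p^*$, and $P=\mathsf P(\mathcal P_n)$ is the set of projections (for $p,q\in P$ one has $pqp\in P$). $\mathsf{PG}(P)$ is the semigroup defined by the semigroup presentation with generators $x_p$ ($p\in P$) and relations $x_p^2=x_p$, $(x_px_q)^2=x_px_q$, $x_px_qx_p=x_{pqp}$ ($p,q\in P$). The maximal subgroup containing the idempotent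 $x_{p_0}$ is its $\mathscr H$-class. *)

theory Defs
  imports "HOL-Algebra.Group" "HOL-Library.Disjoint_Sets"
begin

section \<open>The partition monoid\<close>

text \<open>
  \<open>Top x\<close>, \<open>Bot x\<close> and \<open>Mid x\<close> are the vertices \<open>x\<close>, \<open>x'\<close> and \<open>x''\<close>.
\<close>

datatype vertex = Top nat | Mid nat | Bot nat

definition top_vertices :: "nat \<Rightarrow> vertex set" where
  "top_vertices n = Top ` {1..n}"

definition bot_vertices :: "nat \<Rightarrow> vertex set" where
  "bot_vertices n = Bot ` {1..n}"

definition vertices :: "nat \<Rightarrow> vertex set" where
  "vertices n = top_vertices n \<union> bot_vertices n"

type_synonym diagram = "vertex set set"

definition partition_monoid :: "nat \<Rightarrow> diagram set" where
  "partition_monoid n = {a. partition_on (vertices n) a}"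

text \<open>A partition is represented by the graph in which any two vertices of a block are adjacent.\<close>

definition block_graph :: "diagram \<Rightarrow> (vertex \<times> vertex) set" where
  "block_graph a = {(x, y). \<exists>B\<in>a. x \<in> B \<and> y \<in> B}"

fun bot_to_mid :: "vertex \<Rightarrow> vertex" where
  "bot_to_mid (Bot x) = Mid x"
| "bot_to_mid v = v"

fun top_to_mid :: "vertex \<Rightarrow> vertex" where
  "top_to_mid (Top x) = Mid x"
| "top_to_mid v = v"

definition product_graph :: "diagram \<Rightarrow> diagram \<Rightarrow> (vertex \<times> vertex) set" where
  "product_graph a b =
     map_prod bot_to_mid bot_to_mid ` block_graph a \<union>
     map_prod top_to_mid top_to_mid ` block_graph b"

text \<open>
  The edge relation \<^term>\<open>product_graph a b\<close> is symmetric, so its reflexive transitive closure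
  relates two vertices iff they lie in the same connected component.
\<close>

definition pmult :: "nat \<Rightarrow> diagram \<Rightarrow> diagram \<Rightarrow> diagram" where
  "pmult n a b = vertices n // ((product_graph a b)\<^sup>* \<inter> vertices n \<times> vertices n)"

definition rank :: "nat \<Rightarrow> diagram \<Rightarrow> nat" where
  "rank n a = card {B \<in> a. B \<inter> top_vertices n \<noteq> {} \<and> B \<inter> bot_vertices n \<noteq> {}}"

fun flip :: "vertex \<Rightarrow> vertex" where
  "flip (Top x) = Bot x"
| "flip (Bot x) = Top x"
| "flip (Mid x) = Mid x"

definition star :: "diagram \<Rightarrow> diagram" where
  "star a = (\<lambda>B. flip ` B) ` a"

definition projections :: "nat \<Rightarrow> diagram set" where
  "projections n = {p \<in> partition_monoid n. pmult n p p = p \<and> star p = p}"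


section \<open>Words and presentations\<close>

definition word_step :: "'a set \<Rightarrow> ('a list \<times> 'a list) set \<Rightarrow> ('a list \<times> 'a list) set" where
  "word_step A R = {(u @ l @ v, u @ r @ v) | u l r v. u \<in> lists A \<and> v \<in> lists A \<and> (l, r) \<in> R}"

text \<open>The congruence on the free monoid over \<open>A\<close> generated by \<open>R \<subseteq> lists A \<times> lists A\<close>.\<close>

definition word_cong :: "'a set \<Rightarrow> ('a list \<times> 'a list) set \<Rightarrow> ('a list \<times> 'a list) set" where
  "word_cong A R = (word_step A R \<union> (word_step A R)\<inverse>)\<^sup>* \<inter> lists A \<times> lists A"

text \<open>
  The union below is over all representatives; for classes of a congruence
  it is the class of the concatenation of any two representatives.
\<close>

definition class_mult ::
    "'a set \<Rightarrow> ('a list \<times> 'a list) set \<Rightarrow> 'a list set \<Rightarrow> 'a list set \<Rightarrow> 'a list set" where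
  "class_mult A R X Y = (\<Union>u\<in>X. \<Union>v\<in>Y. word_cong A R `` {u @ v})"

text \<open>
  Semigroup presentations: only nonempty words are used. If both sides of every relation
  are nonempty, the congruence on the free monoid relates the empty word only to itself, and
  restricts to the congruence on the free semigroup generated by the relations.
\<close>

definition presented_semigroup :: "'a set \<Rightarrow> ('a list \<times> 'a list) set \<Rightarrow> 'a list set set" where
  "presented_semigroup A R = (lists A - {[]}) // word_cong A R"


section \<open>The free projection-generated semigroup\<close>

text \<open>The letter \<open>p\<close> plays the role of the generator \<open>x\<^sub>p\<close>; \<open>m\<close> is the ambient product.\<close>

definition PG_rels :: "'a set \<Rightarrow> ('a \<Rightarrow> 'a \<Rightarrow> 'a) \<Rightarrow> ('a list \<times> 'a list) set" where
  "PG_rels P m =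
     {([p, p], [p]) | p. p \<in> P} \<union>
     {([p, q, p, q], [p, q]) | p q. p \<in> P \<and> q \<in> P} \<union>
     {([p, q, p], [m (m p q) p]) | p q. p \<in> P \<and> q \<in> P}"

definition PG :: "'a set \<Rightarrow> ('a \<Rightarrow> 'a \<Rightarrow> 'a) \<Rightarrow> 'a list set set" where
  "PG P m = presented_semigroup P (PG_rels P m)"

definition PG_mult :: "'a set \<Rightarrow> ('a \<Rightarrow> 'a \<Rightarrow> 'a) \<Rightarrow> 'a list set \<Rightarrow> 'a list set \<Rightarrow> 'a list set" where
  "PG_mult P m = class_mult P (PG_rels P m)"

definition PG_gen :: "'a set \<Rightarrow> ('a \<Rightarrow> 'a \<Rightarrow> 'a) \<Rightarrow> 'a \<Rightarrow> 'a list set" where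
  "PG_gen P m p = word_cong P (PG_rels P m) `` {[p]}"


section \<open>Green's relations and maximal subgroups\<close>

text \<open>Here \<open>S\<close> is the carrier and \<open>m\<close> the product of a semigroup.\<close>

definition green_R :: "'a set \<Rightarrow> ('a \<Rightarrow> 'a \<Rightarrow> 'a) \<Rightarrow> ('a \<times> 'a) set" where
  "green_R S m =
     {(a, b). a \<in> S \<and> b \<in> S \<and> insert a ((\<lambda>s. m a s) ` S) = insert b ((\<lambda>s. m b s) ` S)}"

definition green_L :: "'a set \<Rightarrow> ('a \<Rightarrow> 'a \<Rightarrow> 'a) \<Rightarrow> ('a \<times> 'a) set" where
  "green_L S m =
     {(a, b). a \<in> S \<and> b \<in> S \<and> insert a ((\<lambda>s. m s a) ` S) = insert b ((\<lambda>s. m s b) ` S)}"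

definition green_H :: "'a set \<Rightarrow> ('a \<Rightarrow> 'a \<Rightarrow> 'a) \<Rightarrow> ('a \<times> 'a) set" where
  "green_H S m = green_R S m \<inter> green_L S m"

definition maximal_subgroup :: "'a set \<Rightarrow> ('a \<Rightarrow> 'a \<Rightarrow> 'a) \<Rightarrow> 'a \<Rightarrow> 'a monoid" where
  "maximal_subgroup S m e = \<lparr>carrier = green_H S m `` {e}, monoid.mult = m, one = e\<rparr>"


section \<open>Free groups\<close>

text \<open>The letters \<open>(x, True)\<close> and \<open>(x, False)\<close> stand for \<open>x\<close> and its formal inverse.\<close>

definition free_group_rels :: "'a set \<Rightarrow> (('a \<times> bool) list \<times> ('a \<times> bool) list) set" where
  "free_group_rels X = {([(x, b), (x, \<not> b)], []) | x b. x \<in> X}"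

definition free_group :: "'a set \<Rightarrow> ('a \<times> bool) list set monoid" where
  "free_group X =
     \<lparr>carrier = lists (X \<times> UNIV) // word_cong (X \<times> UNIV) (free_group_rels X),
      monoid.mult = class_mult (X \<times> UNIV) (free_group_rels X),
      one = word_cong (X \<times> UNIV) (free_group_rels X) `` {[]}\<rparr>"

definition free_of_rank :: "('a, 'b) monoid_scheme \<Rightarrow> nat \<Rightarrow> bool" where
  "free_of_rank G k \<longleftrightarrow> group G \<and> G \<cong> free_group {..<k}"

end

(* A word in the generators of rank at least n - 1 has a product of rank n - 1 iff, once the letters
   equal to the identity are dropped, consecutive letters are equal or have a product of rank n - 1.
   So it is a walk in the graph whose vertices are the projections of rank n - 1, and on such walks
   the defining relations amount to deleting repetitions and backtracking. Hence the maximal subgroup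
   is the fundamental group of this graph. A projection of rank n - 1 either cuts a single string i or
   joins two strings i, j, and these two kinds are adjacent exactly when the point i lies on the edge
   {i, j}. The graph is thus the complete graph on n points with all edges subdivided, and a spanning
   tree misses (n choose 2) - (n - 1) = (n - 1 choose 2) edges. *)

theory Submission
  imports Defs
begin

section \<open>Word congruences\<close>

text \<open>The relation for pqp also applies when p and q are not adjacent, so deleting
  backtracking is sound only because pqp then leaves the projections of rank at least n - 1. This
  converse of the incidence criterion is the delicate fact about diagrams. Equality of words is
  controlled by an invariant: a partial reading that starts at a vertex, returns the final vertex
  together with a word in the edges outside the tree, and fails when the rank drops. It respects the
  relations, so loops that differ in the free group stay different. In the other direction, every
  word that can be read from p0 back to p0 is pushed into a product of standard loops. All this
  takes place in a locale that knows the graph only through a few sandwich identities and a family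
  of tree walks; diagrams enter when it is interpreted. The tree is rooted at the projection that
  cuts string 1, whereas p0 is arbitrary, so tree walks are rebased at p0.\<close>

lemma equiv_word_cong: "equiv (lists A) (word_cong A R)"
proof (rule equivI)
  have "sym ((word_step A R \<union> (word_step A R)\<inverse>)\<^sup>*)"
    by (intro sym_rtrancl) (auto simp: sym_def)
  then show "sym (word_cong A R)" by (auto simp: word_cong_def sym_def)
  show "refl_on (lists A) (word_cong A R)" by (auto simp: word_cong_def refl_on_def)
  show "trans (word_cong A R)"
    by (auto simp: word_cong_def intro!: transI elim: rtrancl_trans)
  show "word_cong A R \<subseteq> lists A \<times> lists A" by (auto simp: word_cong_def)
qed

lemma word_cong_refl: "u \<in> lists A \<Longrightarrow> (u, u) \<in> word_cong A R"
  by (simp add: word_cong_def)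

lemma word_cong_sym: "(u, v) \<in> word_cong A R \<Longrightarrow> (v, u) \<in> word_cong A R"
  using equiv_word_cong[of A R] by (auto simp: equiv_def sym_def)

lemma word_cong_trans [trans]:
  "(u, v) \<in> word_cong A R \<Longrightarrow> (v, w) \<in> word_cong A R \<Longrightarrow> (u, w) \<in> word_cong A R"
  using equiv_word_cong[of A R] unfolding equiv_def by (blast dest: transD)

lemma word_cong_lists: "(u, v) \<in> word_cong A R \<Longrightarrow> u \<in> lists A \<and> v \<in> lists A"
  by (simp add: word_cong_def)

lemma word_cong_rel:
  assumes "(l, r) \<in> R" "l \<in> lists A" "r \<in> lists A"
  shows "(l, r) \<in> word_cong A R"
proof -
  have "([] @ l @ [], [] @ r @ []) \<in> word_step A R"
    unfolding word_step_def using assms by blast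
  then show ?thesis using assms by (auto simp: word_cong_def)
qed

lemma word_step_context:
  assumes "(u, v) \<in> word_step A R" "x \<in> lists A" "y \<in> lists A"
  shows "(x @ u @ y, x @ v @ y) \<in> word_step A R"
proof -
  obtain s t l r where st: "u = s @ l @ t" "v = s @ r @ t" "s \<in> lists A" "t \<in> lists A" "(l, r) \<in> R"
    using assms(1) by (auto simp: word_step_def)
  then have "(x @ s) @ l @ (t @ y) = x @ u @ y" "(x @ s) @ r @ (t @ y) = x @ v @ y"
    "x @ s \<in> lists A" "t @ y \<in> lists A"
    using assms(2,3) by auto
  then show ?thesis unfolding word_step_def using st(5)
    by (smt (verit) mem_Collect_eq)
qed

lemma word_cong_context:
  assumes "(u, v) \<in> word_cong A R" "x \<in> lists A" "y \<in> lists A"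
  shows "(x @ u @ y, x @ v @ y) \<in> word_cong A R"
proof -
  have "(u, v) \<in> (word_step A R \<union> (word_step A R)\<inverse>)\<^sup>*"
    using assms(1) by (simp add: word_cong_def)
  then have "(x @ u @ y, x @ v @ y) \<in> (word_step A R \<union> (word_step A R)\<inverse>)\<^sup>*"
  proof induction
    case (step v w)
    then have "(x @ v @ y, x @ w @ y) \<in> word_step A R \<union> (word_step A R)\<inverse>"
      using word_step_context[OF _ assms(2,3)] by blast
    with step.IH show ?case by (rule rtrancl_into_rtrancl)
  qed simp
  then show ?thesis using assms by (simp add: word_cong_def)
qed

lemma word_cong_append:
  assumes "(u, u') \<in> word_cong A R" "(v, v') \<in> word_cong A R"
  shows "(u @ v, u' @ v') \<in> word_cong A R"
proof -
  have "(u @ v, u' @ v) \<in> word_cong A R"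
    using word_cong_context[OF assms(1), of "[]" v] word_cong_lists[OF assms(2)] by simp
  also have "(u' @ v, u' @ v') \<in> word_cong A R"
    using word_cong_context[OF assms(2), of "u'" "[]"] word_cong_lists[OF assms(1)] by simp
  finally show ?thesis .
qed

lemma word_cong_class_eq_iff:
  "u \<in> lists A \<Longrightarrow> v \<in> lists A \<Longrightarrow>
    word_cong A R `` {u} = word_cong A R `` {v} \<longleftrightarrow> (u, v) \<in> word_cong A R"
  by (rule eq_equiv_class_iff[OF equiv_word_cong])

text \<open>\<open>word_cong\<close> is compatible with concatenation, so all terms of the union
  over representatives are the same class.\<close>

lemma class_mult_classes:
  assumes "u \<in> lists A" "v \<in> lists A"
  shows "class_mult A R (word_cong A R `` {u}) (word_cong A R `` {v}) = word_cong A R `` {u @ v}"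
proof -
  have "word_cong A R `` {u' @ v'} = word_cong A R `` {u @ v}"
    if "(u, u') \<in> word_cong A R" "(v, v') \<in> word_cong A R" for u' v'
    using word_cong_append[OF that] equiv_class_eq[OF equiv_word_cong] by metis
  then have *: "u' \<in> word_cong A R `` {u} \<Longrightarrow> v' \<in> word_cong A R `` {v} \<Longrightarrow>
      word_cong A R `` {u' @ v'} = word_cong A R `` {u @ v}" for u' v'
    by simp
  have "u \<in> word_cong A R `` {u}" "v \<in> word_cong A R `` {v}"
    using assms by (simp_all add: word_cong_refl)
  then have "\<exists>x. x \<in> word_cong A R `` {u}" "\<exists>x. x \<in> word_cong A R `` {v}" by blast+
  then have ne: "word_cong A R `` {u} \<noteq> {}" "word_cong A R `` {v} \<noteq> {}" by blast+
  have "class_mult A R (word_cong A R `` {u}) (word_cong A R `` {v})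
      = (\<Union>u'\<in>word_cong A R `` {u}. \<Union>v'\<in>word_cong A R `` {v}. word_cong A R `` {u @ v})"
    unfolding class_mult_def by (intro SUP_cong refl *)
  then show ?thesis using ne by simp
qed

text \<open>The intermediate words of a derivation may leave \<open>lists A\<close>, so \<open>l\<close> and \<open>r\<close> range over
  all relations here.\<close>

lemma word_cong_invariant:
  assumes "(u, v) \<in> word_cong A R"
    and refl: "\<And>x. E x x" and sym: "\<And>x y. E x y \<Longrightarrow> E y x" and trans: "\<And>x y z. E x y \<Longrightarrow> E y z \<Longrightarrow> E x z"
    and step: "\<And>x y l r. x \<in> lists A \<Longrightarrow> y \<in> lists A \<Longrightarrow> (l, r) \<in> R \<Longrightarrow> E (f (x @ l @ y)) (f (x @ r @ y))"
  shows "E (f u) (f v)"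
proof -
  have "(u, v) \<in> (word_step A R \<union> (word_step A R)\<inverse>)\<^sup>*"
    using assms(1) by (simp add: word_cong_def)
  then show ?thesis
  proof induction
    case (step v w)
    then have "E (f v) (f w)"
      unfolding word_step_def using assms(5) assms(3)[OF assms(5)] by blast
    with step.IH show ?case by (rule trans)
  qed (rule refl)
qed


section \<open>Free groups\<close>

definition inverse_word :: "('x \<times> bool) list \<Rightarrow> ('x \<times> bool) list" where
  "inverse_word u = rev (map (apsnd Not) u)"

lemma inverse_word_lists: "u \<in> lists (X \<times> UNIV) \<Longrightarrow> inverse_word u \<in> lists (X \<times> UNIV)"
  by (fastforce simp: inverse_word_def)

lemma inverse_word_involutive: "inverse_word (inverse_word u) = u"
  by (induction u) (auto simp: inverse_word_def rev_map apsnd_def map_prod_def)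

lemma free_group_cancel:
  "x \<in> X \<Longrightarrow> ([(x, b), (x, \<not> b)], []) \<in> word_cong (X \<times> UNIV) (free_group_rels X)"
  by (rule word_cong_rel) (auto simp: free_group_rels_def)

lemma append_inverse_word:
  "u \<in> lists (X \<times> UNIV) \<Longrightarrow> (u @ inverse_word u, []) \<in> word_cong (X \<times> UNIV) (free_group_rels X)"
proof (induction u)
  case Nil
  then show ?case by (simp add: inverse_word_def word_cong_refl)
next
  case (Cons a u)
  obtain x b where a: "a = (x, b)" by fastforce
  have x: "x \<in> X" "u \<in> lists (X \<times> UNIV)" using Cons a by auto
  have "([a] @ (u @ inverse_word u) @ [(x, \<not> b)], [a] @ [] @ [(x, \<not> b)]) \<in> word_cong (X \<times> UNIV) (free_group_rels X)"
    by (rule word_cong_context) (use Cons x a in auto)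
  also have "([a] @ [] @ [(x, \<not> b)], []) \<in> word_cong (X \<times> UNIV) (free_group_rels X)"
    using free_group_cancel[OF x(1), of b] by (simp add: a)
  finally show ?case by (simp add: inverse_word_def a)
qed

lemma group_free_group: "group (free_group X)"
proof -
  let ?L = "lists (X \<times> (UNIV :: bool set))" and ?C = "word_cong (X \<times> UNIV) (free_group_rels X)"
  have el: "\<exists>u\<in>?L. Y = ?C `` {u}" if "Y \<in> carrier (free_group X)" for Y
    using that by (auto simp: free_group_def elim: quotientE)
  have carr: "?C `` {u} \<in> carrier (free_group X)" if "u \<in> ?L" for u
    using that by (simp add: free_group_def quotientI)
  have mult: "mult (free_group X) (?C `` {u}) (?C `` {v}) = ?C `` {u @ v}" if "u \<in> ?L" "v \<in> ?L" for u v
    using that by (simp add: free_group_def class_mult_classes)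
  have one: "one (free_group X) = ?C `` {[]}" by (simp add: free_group_def)
  show ?thesis
  proof (rule groupI)
    fix x y assume "x \<in> carrier (free_group X)" "y \<in> carrier (free_group X)"
    then obtain u v where "u \<in> ?L" "v \<in> ?L" "x = ?C `` {u}" "y = ?C `` {v}" using el by blast
    then show "mult (free_group X) x y \<in> carrier (free_group X)" using mult carr by simp
  next
    show "one (free_group X) \<in> carrier (free_group X)" using one carr by simp
  next
    fix x y z assume "x \<in> carrier (free_group X)" "y \<in> carrier (free_group X)" "z \<in> carrier (free_group X)"
    then obtain u v w where "u \<in> ?L" "v \<in> ?L" "w \<in> ?L" "x = ?C `` {u}" "y = ?C `` {v}" "z = ?C `` {w}"
      using el by meson
    then show "mult (free_group X) (mult (free_group X) x y) z = mult (free_group X) x (mult (free_group X) y z)"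
      using mult by simp
  next
    fix x assume "x \<in> carrier (free_group X)"
    then obtain u where u: "u \<in> ?L" "x = ?C `` {u}" using el by meson
    then show "mult (free_group X) (one (free_group X)) x = x" using mult[of "[]" u] one by simp
    have "inverse_word u \<in> ?L" by (rule inverse_word_lists) fact
    have "(inverse_word u @ u, []) \<in> ?C"
      using append_inverse_word[OF inverse_word_lists[OF u(1)]] by (simp add: inverse_word_involutive)
    then have "mult (free_group X) (?C `` {inverse_word u}) x = one (free_group X)"
      unfolding one u(2) mult[OF \<open>inverse_word u \<in> ?L\<close> u(1)]
      by (intro equiv_class_eq[OF equiv_word_cong])
    then show "\<exists>y\<in>carrier (free_group X). mult (free_group X) y x = one (free_group X)"
      using carr \<open>inverse_word u \<in> ?L\<close> by blast
  qed
qed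


section \<open>Green's relations from mutual divisibility\<close>

lemma green_R_mutual:
  assumes assoc: "\<And>x y z. x \<in> S \<Longrightarrow> y \<in> S \<Longrightarrow> z \<in> S \<Longrightarrow> m (m x y) z = m x (m y z)"
    and closed: "\<And>x y. x \<in> S \<Longrightarrow> y \<in> S \<Longrightarrow> m x y \<in> S"
    and "a \<in> S" "b \<in> S" "s \<in> S" "t \<in> S" "b = m a s" "a = m b t"
  shows "(a, b) \<in> green_R S m"
proof -
  have "insert y (m y ` S) \<subseteq> insert x (m x ` S)"
    if "x \<in> S" "s \<in> S" "y = m x s" for x y s
    using that assoc closed by auto
  from this[of a s b] this[of b t a] show ?thesis
    using assms unfolding green_R_def by blast
qed

lemma green_L_mutual:
  assumes assoc: "\<And>x y z. x \<in> S \<Longrightarrow> y \<in> S \<Longrightarrow> z \<in> S \<Longrightarrow> m (m x y) z = m x (m y z)"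
    and closed: "\<And>x y. x \<in> S \<Longrightarrow> y \<in> S \<Longrightarrow> m x y \<in> S"
    and "a \<in> S" "b \<in> S" "s \<in> S" "t \<in> S" "b = m s a" "a = m t b"
  shows "(a, b) \<in> green_L S m"
proof -
  have "insert y ((\<lambda>z. m z y) ` S) \<subseteq> insert x ((\<lambda>z. m z x) ` S)"
    if "x \<in> S" "s \<in> S" "y = m s x" for x y s
    using that assoc[symmetric] closed by auto
  from this[of a s b] this[of b t a] show ?thesis
    using assms unfolding green_L_def by blast
qed

text \<open>The letter \<open>e\<close> acts as an identity, \<open>V\<close> holds the vertices and
  \<open>F\<close> the edges, with a loop at each vertex so that a repeated letter is a legal step.
  \<open>lab\<close> is empty on tree edges. Each \<open>x\<close> in \<open>X\<close> names an edge
  outside the tree; it reads as \<open>(x, b)\<close> when left from its end \<open>src x b\<close>.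
  \<open>t p\<close> is a tree walk to \<open>p\<close> from a fixed root, which may differ from
  \<open>p0\<close>. By \<open>t_tree\<close>, a step along a tree edge turns one such walk into the
  next up to the relations; in this form the contractibility of the tree enters.\<close>

locale pg_graph =
  fixes P :: "'a set" and m :: "'a \<Rightarrow> 'a \<Rightarrow> 'a" and e p0 :: 'a and V :: "'a set"
    and F :: "'a \<Rightarrow> 'a \<Rightarrow> bool"
    and X :: "'x set" and lab :: "'a \<Rightarrow> 'a \<Rightarrow> ('x \<times> bool) list" and src :: "'x \<Rightarrow> bool \<Rightarrow> 'a"
    and t :: "'a \<Rightarrow> 'a list"
  assumes V_P: "V \<subseteq> P" and e_P: "e \<in> P" and e_V: "e \<notin> V" and p0_V: "p0 \<in> V"
    and F_V: "F p q \<Longrightarrow> p \<in> V \<and> q \<in> V"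
    and F_refl: "p \<in> V \<Longrightarrow> F p p"
    and F_sym: "F p q \<Longrightarrow> F q p"
    and id_sandwich: "q \<in> P \<Longrightarrow> m (m e q) e = q"
    and sandwich_id: "q \<in> P \<Longrightarrow> m (m q e) q = q"
    and sandwich: "F p q \<Longrightarrow> m (m p q) p = p"
    and not_sandwich: "p \<in> P \<Longrightarrow> q \<in> P \<Longrightarrow> p \<noteq> e \<Longrightarrow> q \<noteq> e \<Longrightarrow> \<not> F p q \<Longrightarrow> m (m p q) p \<notin> insert e V"
    and src_F: "x \<in> X \<Longrightarrow> F (src x b) (src x (\<not> b))"
    and lab_src: "x \<in> X \<Longrightarrow> lab (src x b) (src x (\<not> b)) = [(x, b)]"
    and lab_cases: "F p q \<Longrightarrow> lab p q = [] \<or> (\<exists>x\<in>X. \<exists>b. p = src x b \<and> q = src x (\<not> b))"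
    and t_ends: "p \<in> V \<Longrightarrow> t p \<noteq> [] \<and> hd (t p) = hd (t p0) \<and> last (t p) = p"
    and t_path: "p \<in> V \<Longrightarrow> successively (\<lambda>p q. F p q \<and> lab p q = []) (t p)"
    and t_tree: "F p q \<Longrightarrow> lab p q = [] \<Longrightarrow> (t p @ [q], t q) \<in> word_cong P (PG_rels P m)"
begin

abbreviation cong (infix "\<approx>" 50) where
  "u \<approx> v \<equiv> (u, v) \<in> word_cong P (PG_rels P m)"

abbreviation fcong (infix "\<simeq>" 50) where
  "u \<simeq> v \<equiv> (u, v) \<in> word_cong (X \<times> UNIV) (free_group_rels X)"

lemma in_P: "p \<in> V \<Longrightarrow> p \<in> P"
  using V_P by blast

lemma rel_idem: "p \<in> P \<Longrightarrow> [p, p] \<approx> [p]"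
  by (rule word_cong_rel) (auto simp: PG_rels_def)

lemma rel_sandwich: "F p q \<Longrightarrow> [p, q, p] \<approx> [p]"
  by (rule word_cong_rel) (use F_V[of p q] in_P in \<open>auto simp: PG_rels_def sandwich intro!: exI[of _ p] exI[of _ q]\<close>)

lemma rel_id_sandwich: "p \<in> P \<Longrightarrow> [e, p, e] \<approx> [p]"
  by (rule word_cong_rel) (use e_P in \<open>auto simp: PG_rels_def id_sandwich intro!: exI[of _ e] exI[of _ p]\<close>)

text \<open>The two-sided law \<open>[e, p, e] \<approx> [p]\<close> becomes one-sided by expanding
  \<open>p\<close> and merging the two adjacent copies of \<open>e\<close>.\<close>

lemma rel_right_id: "p \<in> P \<Longrightarrow> [p, e] \<approx> [p]"
proof -
  assume p: "p \<in> P"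
  have "[p] @ [e] \<approx> [e, p, e] @ [e]"
    by (intro word_cong_append word_cong_refl word_cong_sym[OF rel_id_sandwich]) (use p e_P in auto)
  also have "[e, p, e] @ [e] = [e, p] @ [e, e]" by simp
  also have "[e, p] @ [e, e] \<approx> [e, p] @ [e]"
    by (intro word_cong_append word_cong_refl rel_idem) (use p e_P in auto)
  also have "[e, p] @ [e] \<approx> [p]" using rel_id_sandwich[OF p] by simp
  finally show ?thesis by simp
qed


section \<open>Reading a word as a walk\<close>

text \<open>\<^term>\<open>run p w\<close> follows the letters of \<^term>\<open>w\<close> from the vertex \<^term>\<open>p\<close>, skipping \<^term>\<open>e\<close>, and
  returns the final vertex with the word read off from the labels; it fails as soon as the
  product of the letters would drop in rank.\<close>

fun run :: "'a \<Rightarrow> 'a list \<Rightarrow> ('a \<times> ('x \<times> bool) list) option" where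
  "run p [] = Some (p, [])"
| "run p (q # w) = (if q = e then run p w
    else if F p q then map_option (apsnd ((@) (lab p q))) (run q w) else None)"

lemma run_append:
  "run p (u @ v) = (case run p u of None \<Rightarrow> None
    | Some (q, x) \<Rightarrow> map_option (apsnd ((@) x)) (run q v))"
proof (induction u arbitrary: p)
  case Nil
  then show ?case by (cases "run p v") auto
next
  case (Cons a u)
  have "map_option (apsnd ((@) l)) (map_option (apsnd ((@) b)) y) = map_option (apsnd ((@) (l @ b))) y"
    for l b and y :: "('a \<times> ('x \<times> bool) list) option"
    by (cases y) auto
  then show ?case using Cons by (auto split: option.splits)
qed

lemma run_V: "p \<in> V \<Longrightarrow> run p w = Some (q, x) \<Longrightarrow> q \<in> V"
proof (induction w arbitrary: p x)
  case (Cons a w)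
  then show ?case using F_V[of p a] by (auto split: if_splits)
qed auto

lemma lab_lists: "F p q \<Longrightarrow> lab p q \<in> lists (X \<times> UNIV)"
  using lab_cases[of p q] lab_src by fastforce

lemma run_lists: "run p w = Some (q, x) \<Longrightarrow> x \<in> lists (X \<times> UNIV)"
proof (induction w arbitrary: p x)
  case (Cons a w)
  then show ?case using lab_lists[of p a] by (fastforce split: if_splits)
qed auto

text \<open>A nonempty label identifies an edge outside the tree, which \<open>lab_src\<close>
  labels in both directions.\<close>

lemma lab_Nil_sym: "F p q \<Longrightarrow> lab p q = [] \<Longrightarrow> lab q p = []"
proof (rule ccontr)
  assume F: "F p q" and *: "lab p q = []" "lab q p \<noteq> []"
  then obtain x b where "x \<in> X" "q = src x b" "p = src x (\<not> b)"
    using lab_cases[OF F_sym[OF F]] by blast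
  then show False using * lab_src[of x "\<not> b"] by simp
qed

lemma lab_refl: "p \<in> V \<Longrightarrow> lab p p = []"
proof (rule ccontr)
  assume p: "p \<in> V" and *: "lab p p \<noteq> []"
  then obtain x b where "x \<in> X" "p = src x b" "p = src x (\<not> b)"
    using lab_cases[OF F_refl[OF p]] by blast
  then show False using lab_src[of x b] lab_src[of x "\<not> b"] by simp
qed

lemma lab_cancel: "F p q \<Longrightarrow> lab p q @ lab q p \<simeq> []"
proof -
  assume F: "F p q"
  have "lab p q @ lab q p \<simeq> []" if "x \<in> X" "p = src x b" "q = src x (\<not> b)" for x b
    using that lab_src[of x b] lab_src[of x "\<not> b"] free_group_cancel[of x X b] by simp
  then show ?thesis
    using lab_cases[OF F] lab_Nil_sym[OF F] by (auto simp: word_cong_refl)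
qed

lemma tree_sym: "F p q \<and> lab p q = [] \<Longrightarrow> F q p \<and> lab q p = []"
  using lab_Nil_sym F_sym by blast

text \<open>Equality is added to \<open>\<simeq>\<close> because the latter is reflexive only on
  words over \<open>X \<times> UNIV\<close>, whereas \<open>word_cong_invariant\<close> asks for a
  relation that is reflexive everywhere.\<close>

definition run_equiv :: "('a \<times> ('x \<times> bool) list) option \<Rightarrow> ('a \<times> ('x \<times> bool) list) option \<Rightarrow> bool" where
  "run_equiv = rel_option (rel_prod (=) (\<lambda>x y. x = y \<or> x \<simeq> y))"

lemma run_equiv_refl: "run_equiv s s"
  unfolding run_equiv_def by (intro option.rel_refl prod.rel_refl) auto

lemma run_equiv_sym: "run_equiv r s \<Longrightarrow> run_equiv s r"
  unfolding run_equiv_def by (auto simp: option_rel_Some1 elim!: option.rel_cases intro: word_cong_sym)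

lemma run_equiv_trans: "run_equiv q r \<Longrightarrow> run_equiv r s \<Longrightarrow> run_equiv q s"
  unfolding run_equiv_def by (auto elim!: option.rel_cases intro: word_cong_trans)

lemma run_equiv_Some:
  "run_equiv (Some (p, x)) s \<Longrightarrow> \<exists>y. s = Some (p, y) \<and> (x = y \<or> x \<simeq> y)"
  by (cases s) (auto simp: run_equiv_def)

text \<open>Repetitions contribute an empty label and backtracking a cancelling pair, so the word
  read changes only within the free group. The critical case is a sandwich over a pair that is not
  an edge.\<close>

lemma run_rel:
  assumes "(l, r) \<in> PG_rels P m" "p \<in> V"
  shows "run_equiv (run p l) (run p r)"
proof -
  consider q where "q \<in> P" "l = [q, q]" "r = [q]"
    | q s where "q \<in> P" "s \<in> P" "l = [q, s, q, s]" "r = [q, s]"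
    | q s where "q \<in> P" "s \<in> P" "l = [q, s, q]" "r = [m (m q s) q]"
    using assms(1) by (auto simp: PG_rels_def)
  then show ?thesis
  proof cases
    case 1
    then show ?thesis using F_refl lab_refl F_V[of p q]
      by (auto simp: run_equiv_def)
  next
    case 2
    have c: "lab p q @ lab q s @ lab s q @ lab q s \<simeq> lab p q @ lab q s" if "F p q" "F q s"
      using word_cong_context[OF lab_cancel[OF that(2)], of "lab p q" "lab q s"]
        lab_lists that by auto
    show ?thesis using 2 F_refl lab_refl F_V[of p q] F_V[of q s] F_V[of p s] F_sym c
      by (auto simp: run_equiv_def)
  next
    case 3
    have c: "lab p q @ lab q s @ lab s q \<simeq> lab p q" if "F p q" "F q s"
      using word_cong_context[OF lab_cancel[OF that(2)], of "lab p q" "[]"] lab_lists that by auto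
    consider "q = e" | "q \<noteq> e" "s = e" | "q \<noteq> e" "s \<noteq> e" "F q s" | "q \<noteq> e" "s \<noteq> e" "\<not> F q s" by blast
    then show ?thesis
    proof cases
      case 1
      then show ?thesis using 3 id_sandwich by (simp add: run_equiv_refl)
    next
      case 2
      then show ?thesis using 3 sandwich_id F_refl lab_refl F_V[of p q]
        by (auto simp: run_equiv_def)
    next
      case 3
      then show ?thesis using \<open>l = _\<close> \<open>r = _\<close> sandwich c F_sym by (auto simp: run_equiv_def)
    next
      case 4
      \<comment> \<open>Both readings fail: on the left the step from \<open>q\<close> to
        \<open>s\<close> is not an edge, and on the right the single letter is neither
        \<open>e\<close> nor a vertex.\<close>
      then have "\<not> F p (m (m q s) q)" "m (m q s) q \<noteq> e"
        using not_sandwich[of q s] 3 F_V[of p "m (m q s) q"] by auto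
      then show ?thesis using 3 4 by (auto simp: run_equiv_def)
    qed
  qed
qed

text \<open>The prefix fixes the vertex at which the relation is read. By \<open>run_rel\<close>
  both sides then fail or end at a common vertex, from which the suffix is read in the same
  way.\<close>

lemma run_cong:
  assumes "u \<approx> v" "p \<in> V"
  shows "run_equiv (run p u) (run p v)"
proof (rule word_cong_invariant[OF assms(1), of run_equiv "run p"])
  fix x y l r assume "(l, r) \<in> PG_rels P m"
  show "run_equiv (run p (x @ l @ y)) (run p (x @ r @ y))"
  proof (cases "run p x")
    case (Some s)
    obtain q z where s: "s = (q, z)" by fastforce
    have "q \<in> V" "z \<in> lists (X \<times> UNIV)" using run_V run_lists assms(2) Some s by blast+
    have "run_equiv (run q l) (run q r)" by (rule run_rel) fact+
    then show ?thesis
    proof (cases "run q l")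
      case None
      then have "run q r = None"
        using run_rel[OF \<open>(l, r) \<in> _\<close> \<open>q \<in> V\<close>] by (auto simp: run_equiv_def)
      then show ?thesis using None by (simp add: run_append Some s run_equiv_refl)
    next
      case (Some s')
      obtain q' z' where s': "s' = (q', z')" by fastforce
      obtain z'' where z'': "run q r = Some (q', z'')" "z' = z'' \<or> z' \<simeq> z''"
        using run_equiv_Some[of q' z' "run q r"] \<open>run_equiv (run q l) (run q r)\<close> Some s' by auto
      have "z @ z' @ v \<simeq> z @ z'' @ v" if "v \<in> lists (X \<times> UNIV)" for v
        using z''(2)
      proof
        assume "z' = z''"
        then show ?thesis using that \<open>z \<in> lists (X \<times> UNIV)\<close> run_lists[OF z''(1)] by (simp add: word_cong_refl)
      next
        assume "z' \<simeq> z''"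
        from word_cong_context[OF this \<open>z \<in> lists (X \<times> UNIV)\<close> that] show ?thesis .
      qed
      then show ?thesis
        using run_lists[of q' y]
        by (cases "run q' y")
          (auto simp: run_append \<open>run p x = Some s\<close> s Some s' z''(1) run_equiv_def)
    qed
  qed (simp add: run_append run_equiv_refl)
qed (auto intro: run_equiv_refl run_equiv_sym run_equiv_trans)

lemma run_cong_Some:
  assumes "u \<approx> v" "p \<in> V" "run p u = Some (q, x)"
  obtains y where "run p v = Some (q, y)" "x \<simeq> y"
proof -
  obtain y where "run p v = Some (q, y)" "x = y \<or> x \<simeq> y"
    using run_cong[OF assms(1,2)] run_equiv_Some[of q x "run p v"] assms(3) by auto
  moreover have "x \<simeq> x" by (rule word_cong_refl) (rule run_lists[OF assms(3)])
  ultimately show thesis using that by blast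
qed


section \<open>Loops\<close>

text \<open>Cancellation starts at the innermost letters: \<open>x, x\<close> merges to
  \<open>x\<close>, then \<open>y, x, y\<close> becomes \<open>y\<close>. Doubling this
  \<open>y\<close> restores the shape for the shorter walk.\<close>

lemma rev_cancel:
  "successively F w \<Longrightarrow> w \<noteq> [] \<Longrightarrow> set w \<subseteq> V \<Longrightarrow> rev w @ w \<approx> [last w]"
proof (induction w rule: induct_list012)
  case (2 x)
  then show ?case using rel_idem in_P by simp
next
  case (3 x y zs)
  have P: "x \<in> P" "y \<in> P" "zs \<in> lists P" using 3 in_P by auto
  have yxy: "[y, x, y] \<approx> [y]" using rel_sandwich F_sym 3 by auto
  have "rev (y # zs) @ [x, x] @ (y # zs) \<approx> rev (y # zs) @ [x] @ (y # zs)"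
    by (intro word_cong_append word_cong_refl rel_idem) (use P in auto)
  also have "rev (y # zs) @ [x] @ (y # zs) = rev zs @ [y, x, y] @ zs" by simp
  also have "\<dots> \<approx> rev zs @ [y] @ zs"
    by (intro word_cong_append word_cong_refl yxy) (use P in auto)
  also have "rev zs @ [y] @ zs \<approx> rev zs @ [y, y] @ zs"
    by (intro word_cong_append word_cong_refl word_cong_sym[OF rel_idem]) (use P in auto)
  also have "rev zs @ [y, y] @ zs = rev (y # zs) @ (y # zs)" by simp
  also have "\<dots> \<approx> [last (y # zs)]" using 3 by (intro "3.IH"(2)) auto
  finally show ?case by simp
qed auto

lemma t_V: "p \<in> V \<Longrightarrow> set (t p) \<subseteq> V"
proof -
  assume p: "p \<in> V"
  have "set w \<subseteq> V" if "successively (\<lambda>p q. F p q \<and> lab p q = []) w" "w \<noteq> []" "last w \<in> V" for w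
    using that
  proof (induction w)
    case (Cons a w)
    then show ?case using F_V[of a "hd w"] by (cases "w = []") (auto simp: successively_Cons)
  qed auto
  then show ?thesis using t_path[OF p] t_ends[OF p] p by auto
qed

text \<open>Tree walks are rebased from the root to \<open>p0\<close>: back to the root, then out to
  \<open>p\<close>. A common stretch is left in place, since the relations cancel it.\<close>

definition T :: "'a \<Rightarrow> 'a list" where
  "T p = rev (t p0) @ t p"

lemma T_ends: "p \<in> V \<Longrightarrow> T p \<noteq> [] \<and> hd (T p) = p0 \<and> last (T p) = p"
  using t_ends[of p] t_ends[OF p0_V] by (auto simp: T_def hd_rev)

lemma T_path: "p \<in> V \<Longrightarrow> successively (\<lambda>p q. F p q \<and> lab p q = []) (T p)"
proof -
  assume p: "p \<in> V"
  have "successively (\<lambda>p q. F p q \<and> lab p q = []) (rev (t p0))"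
    unfolding successively_rev by (rule successively_mono[OF t_path[OF p0_V]]) (rule tree_sym)
  moreover have "last (rev (t p0)) = hd (t p)" "hd (t p) \<in> V"
    using t_ends[OF p] t_ends[OF p0_V] t_V[OF p0_V] by (auto simp: last_rev)
  ultimately show ?thesis
    unfolding T_def successively_append_iff using t_path[OF p] F_refl lab_refl by simp
qed

lemma T_V: "p \<in> V \<Longrightarrow> set (T p) \<subseteq> V"
  using t_V p0_V by (simp add: T_def)

lemma T_P: "p \<in> V \<Longrightarrow> T p \<in> lists P"
  using T_V[of p] in_P by auto

lemma butlast_T_P: "p \<in> V \<Longrightarrow> butlast (T p) \<in> lists P"
  using T_P[of p] by (meson in_listsD in_listsI in_set_butlastD)

lemma T_F: "p \<in> V \<Longrightarrow> successively F (T p)"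
  by (rule successively_mono[OF T_path]) auto

lemma T_tree:
  assumes "F p q" "lab p q = []"
  shows "T p @ [q] \<approx> T q"
proof -
  have "rev (t p0) @ (t p @ [q]) \<approx> rev (t p0) @ t q"
    by (intro word_cong_append word_cong_refl t_tree assms) (use t_V[OF p0_V] in_P in auto)
  then show ?thesis by (simp add: T_def)
qed

text \<open>In groupoid terms \<open>T p\<close> is an arrow from \<open>p0\<close> to
  \<open>p\<close>, its reversal is the inverse arrow, and the one-letter words are the identities
  at the two ends.\<close>

lemma T_rev_cancel:
  assumes "p \<in> V"
  shows "rev (T p) @ T p \<approx> [p]" "T p @ rev (T p) \<approx> [p0]"
proof -
  show "rev (T p) @ T p \<approx> [p]"
    using rev_cancel[OF T_F[OF assms] _ T_V[OF assms]] T_ends[OF assms] by simp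
  have "successively F (rev (T p))"
    unfolding successively_rev by (rule successively_mono[OF T_F[OF assms]]) (rule F_sym)
  then show "T p @ rev (T p) \<approx> [p0]"
    using rev_cancel[of "rev (T p)"] T_ends[OF assms] T_V[OF assms] by (simp add: last_rev)
qed

lemma T_p0: "T p0 \<approx> [p0]"
  unfolding T_def
  using rev_cancel[OF successively_mono[OF t_path[OF p0_V]] _ t_V[OF p0_V]] t_ends[OF p0_V] by simp

text \<open>The usual generator of a fundamental group: out along the tree, across an edge outside
  it, back along the tree. The crossing is the junction of the two walks and has no letter of its
  own.\<close>

definition loop :: "'x \<times> bool \<Rightarrow> 'a list" where
  "loop a = T (src (fst a) (snd a)) @ rev (T (src (fst a) (\<not> snd a)))"

text \<open>The leading \<open>p0\<close> keeps the word nonempty and sends the empty word to the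
  group identity.\<close>

definition loops :: "('x \<times> bool) list \<Rightarrow> 'a list" where
  "loops u = p0 # concat (map loop u)"

lemma src_V: "x \<in> X \<Longrightarrow> src x b \<in> V"
  using src_F F_V by blast

lemma loop_P: "a \<in> X \<times> UNIV \<Longrightarrow> loop a \<in> lists P"
  using T_P[OF src_V, of "fst a"] by (fastforce simp: loop_def)

lemma loops_P: "u \<in> lists (X \<times> UNIV) \<Longrightarrow> loops u \<in> lists P"
  using loop_P in_P[OF p0_V] by (force simp: loops_def)

lemma absorb_last:
  assumes "w \<in> lists P" "w \<noteq> []"
  shows "w @ [last w] \<approx> w"
proof -
  obtain v a where w: "w = v @ [a]" using assms(2) by (cases w rule: rev_cases) auto
  have "v @ [a, a] \<approx> v @ [a]"
    by (intro word_cong_append word_cong_refl rel_idem) (use assms w in auto)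
  then show ?thesis using w by simp
qed

lemma absorb_hd:
  assumes "w \<in> lists P" "w \<noteq> []"
  shows "hd w # w \<approx> w"
proof -
  have *: "tl w \<in> lists P" "hd w \<in> P" using assms by (auto simp: list.set_sel)
  have "[hd w, hd w] @ tl w \<approx> [hd w] @ tl w"
    by (intro word_cong_append word_cong_refl rel_idem *)
  then show ?thesis using assms by simp
qed

text \<open>Each loop returns to \<open>p0\<close>, so one more \<open>p0\<close> is a
  repetition.\<close>

lemma loops_p0: "u \<in> lists (X \<times> UNIV) \<Longrightarrow> loops u @ [p0] \<approx> loops u"
proof -
  assume u: "u \<in> lists (X \<times> UNIV)"
  have "last (loops u) = p0"
  proof (cases u rule: rev_cases)
    case (snoc v a)
    then have "last (loop a) = p0" "loop a \<noteq> []"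
      using u T_ends[OF src_V, of "fst a"] by (auto simp: loop_def last_rev)
    then show ?thesis using snoc by (auto simp: loops_def)
  qed (simp add: loops_def)
  then show ?thesis using absorb_last[OF loops_P[OF u]] by (simp add: loops_def)
qed

lemma loops_append:
  assumes "u \<in> lists (X \<times> UNIV)" "v \<in> lists (X \<times> UNIV)"
  shows "loops (u @ v) \<approx> loops u @ loops v"
proof -
  have "loops u @ concat (map loop v) \<approx> (loops u @ [p0]) @ concat (map loop v)"
    by (intro word_cong_append word_cong_refl word_cong_sym[OF loops_p0])
      (use assms loop_P in \<open>auto, blast\<close>)
  then show ?thesis by (simp add: loops_def)
qed

lemma p0_loops: "u \<in> lists (X \<times> UNIV) \<Longrightarrow> [p0] @ loops u \<approx> loops u"
  using absorb_hd[OF loops_P] by (simp add: loops_def)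

text \<open>Counterpart of \<open>T_tree\<close> for edges outside the tree: crossing one emits its
  loop.\<close>

lemma T_edge:
  assumes "x \<in> X"
  shows "T (src x b) @ [src x (\<not> b)] \<approx> loop (x, b) @ T (src x (\<not> b))"
proof -
  have "T (src x b) @ [src x (\<not> b)] \<approx> T (src x b) @ rev (T (src x (\<not> b))) @ T (src x (\<not> b))"
    by (intro word_cong_append word_cong_refl word_cong_sym[OF T_rev_cancel(1)] src_V T_P assms)
  then show ?thesis by (simp add: loop_def)
qed

text \<open>The way back of the first loop cancels the way out of the second, down to the far end of
  the edge. What remains crosses the edge and returns at once, which is a sandwich.\<close>

lemma loop_cancel:
  assumes x: "x \<in> X"
  shows "loop (x, b) @ loop (x, \<not> b) \<approx> [p0]"
proof -
  let ?s = "src x b" and ?t = "src x (\<not> b)"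
  have V: "?s \<in> V" "?t \<in> V" using src_V x by auto
  have "loop (x, b) @ loop (x, \<not> b) = T ?s @ (rev (T ?t) @ T ?t) @ rev (T ?s)"
    by (simp add: loop_def)
  also have "\<dots> \<approx> T ?s @ [?t] @ rev (T ?s)"
    by (intro word_cong_append word_cong_refl T_rev_cancel V T_P) (use T_P[OF V(1)] in auto)
  also have "T ?s = butlast (T ?s) @ [?s]"
    using T_ends[OF V(1)] by (metis append_butlast_last_id)
  also have "(butlast (T ?s) @ [?s]) @ [?t] @ rev (butlast (T ?s) @ [?s]) =
      butlast (T ?s) @ [?s, ?t, ?s] @ rev (butlast (T ?s))" by simp
  also have "\<dots> \<approx> butlast (T ?s) @ [?s] @ rev (butlast (T ?s))"
    by (intro word_cong_append word_cong_refl rel_sandwich src_F x)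
      (use butlast_T_P[OF V(1)] in auto)
  \<comment> \<open>The turning point is doubled so that \<open>T ?s\<close> and its reversal both
    reappear in full.\<close>
  also have "butlast (T ?s) @ [?s] @ rev (butlast (T ?s)) \<approx> butlast (T ?s) @ [?s, ?s] @ rev (butlast (T ?s))"
    by (intro word_cong_append word_cong_refl word_cong_sym[OF rel_idem] in_P V)
      (use butlast_T_P[OF V(1)] in auto)
  also have "butlast (T ?s) @ [?s, ?s] @ rev (butlast (T ?s))
     = (butlast (T ?s) @ [?s]) @ rev (butlast (T ?s) @ [?s])" by simp
  also have "butlast (T ?s) @ [?s] = T ?s"
    using T_ends[OF V(1)] by (metis append_butlast_last_id)
  also have "T ?s @ rev (T ?s) \<approx> [p0]" by (rule T_rev_cancel) fact
  finally show ?thesis .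
qed

lemma run_tree_path:
  assumes "successively (\<lambda>p q. F p q \<and> lab p q = []) (p # w)" "p \<in> V"
  shows "run p w = Some (last (p # w), [])"
  using assms
proof (induction w arbitrary: p)
  case (Cons a w)
  then have "a \<in> V" using F_V[of p a] by auto
  then show ?case using Cons e_V by (auto simp: apsnd_def)
qed simp

lemma run_loop:
  assumes x: "x \<in> X"
  shows "run p0 (loop (x, b)) = Some (p0, [(x, b)])"
proof -
  let ?s = "src x b" and ?t = "src x (\<not> b)"
  have V: "?s \<in> V" "?t \<in> V" using src_V x by auto
  let ?tr = "\<lambda>p q. F p q \<and> lab p q = []"
  have "successively ?tr (p0 # T ?s)"
    using T_path[OF V(1)] T_ends[OF V(1)] F_refl lab_refl p0_V by (simp add: successively_Cons)
  then have s: "run p0 (T ?s) = Some (?s, [])"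
    using run_tree_path p0_V T_ends[OF V(1)] by simp
  have "successively ?tr (rev (T ?t))"
    unfolding successively_rev by (rule successively_mono[OF T_path[OF V(2)]]) (rule tree_sym)
  then obtain w where w: "rev (T ?t) = ?t # w" "successively ?tr (?t # w)"
    using T_ends[OF V(2)] by (metis hd_rev list.collapse rev_is_Nil_conv)
  have "last (?t # w) = p0" using T_ends[OF V(2)] w(1) by (metis last_rev)
  then have "run ?t w = Some (p0, [])" using run_tree_path[OF w(2) V(2)] by simp
  then have "run ?s (?t # w) = Some (p0, [(x, b)])"
    using src_F[OF x, of b] lab_src[OF x, of b] e_V V by auto
  then show ?thesis by (simp add: loop_def run_append s w(1) apsnd_def)
qed

text \<open>The crossing is the only labelled step of a loop, so reading recovers \<open>u\<close>
  letter for letter. This makes \<open>loops\<close> injective on the free group.\<close>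

lemma run_loops: "u \<in> lists (X \<times> UNIV) \<Longrightarrow> run p0 (loops u) = Some (p0, u)"
proof -
  assume "u \<in> lists (X \<times> UNIV)"
  then have "run p0 (concat (map loop u)) = Some (p0, u)"
    by (induction u) (auto simp: run_append run_loop)
  then show ?thesis using e_V p0_V F_refl lab_refl by (auto simp: loops_def)
qed

lemma loops_cong: "u \<simeq> v \<Longrightarrow> loops u \<approx> loops v"
proof -
  assume uv: "u \<simeq> v"
  have step: "loops (x @ l @ y) \<approx> loops (x @ r @ y)"
    if xy: "x \<in> lists (X \<times> UNIV)" "y \<in> lists (X \<times> UNIV)" and rel: "(l, r) \<in> free_group_rels X" for x y and l r :: "('x \<times> bool) list"
  proof -
    obtain a b where a: "l = [(a, b), (a, \<not> b)]" "r = []" "a \<in> X"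
      using rel unfolding free_group_rels_def by blast
    have P: "loops x \<in> lists P" "concat (map loop y) \<in> lists P"
      using loops_P xy loop_P by (auto, blast)
    have "loops x @ (loop (a, b) @ loop (a, \<not> b)) @ concat (map loop y) \<approx> loops x @ [p0] @ concat (map loop y)"
      by (intro word_cong_append word_cong_refl loop_cancel a P)
    also have "loops x @ [p0] @ concat (map loop y) = (loops x @ [p0]) @ concat (map loop y)" by simp
    also have "\<dots> \<approx> loops x @ concat (map loop y)"
      by (intro word_cong_append word_cong_refl loops_p0 xy P)
    finally show ?thesis by (simp add: loops_def a)
  qed
  \<comment> \<open>Equality is offered as an alternative because \<open>\<approx>\<close> is
    reflexive only on words over \<open>P\<close>.\<close>
  have "loops u = loops v \<or> loops u \<approx> loops v"
    by (rule word_cong_invariant[OF uv, of "\<lambda>x y. x = y \<or> x \<approx> y" loops])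
      (auto intro: word_cong_sym word_cong_trans step)
  moreover have "loops u \<approx> loops u"
    using word_cong_lists[OF uv] by (intro word_cong_refl loops_P) blast
  ultimately show ?thesis by auto
qed

lemma cong_loops_iff:
  assumes "u \<in> lists (X \<times> UNIV)" "v \<in> lists (X \<times> UNIV)"
  shows "loops u \<approx> loops v \<longleftrightarrow> u \<simeq> v"
proof
  assume "loops u \<approx> loops v"
  then obtain y where "run p0 (loops v) = Some (p0, y)" "u \<simeq> y"
    using run_cong_Some[OF _ p0_V run_loops[OF assms(1)]] by metis
  then show "u \<simeq> v" using run_loops[OF assms(2)] by simp
qed (rule loops_cong)

text \<open>The tree walk is pushed to the right one letter at a time: \<open>e\<close> is absorbed,
  a tree edge turns \<open>T p\<close> into the next tree walk, and any other edge leaves its loop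
  behind on the left.\<close>

lemma walk_normal_form:
  assumes "w \<in> lists P" "p \<in> V" "run p w = Some (q, x)"
  shows "T p @ w \<approx> concat (map loop x) @ T q"
  using assms
proof (induction w arbitrary: p x)
  case Nil
  then show ?case using T_P[of p] by (simp add: word_cong_refl)
next
  case (Cons a w)
  have w: "w \<in> lists P" using Cons by simp
  show ?case
  proof (cases "a = e")
    case True
    have "T p @ [e] \<approx> T p"
    proof -
      have "butlast (T p) @ [p, e] \<approx> butlast (T p) @ [p]"
        by (intro word_cong_append word_cong_refl rel_right_id)
          (use T_P[of p] in_P Cons in \<open>auto dest: in_set_butlastD\<close>)
      moreover have "T p = butlast (T p) @ [p]"
        using T_ends[of p] Cons by (metis append_butlast_last_id)
      ultimately show ?thesis by (metis append_Cons append_Nil append_assoc)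
    qed
    then have "(T p @ [e]) @ w \<approx> T p @ w"
      by (intro word_cong_append word_cong_refl w)
    also have "T p @ w \<approx> concat (map loop x) @ T q"
      using Cons True by (intro Cons.IH) auto
    finally show ?thesis using True by simp
  next
    case False
    then obtain y where y: "F p a" "run a w = Some (q, y)" "x = lab p a @ y"
      using Cons.prems by (auto split: if_splits)
    have a: "a \<in> V" using F_V y by blast
    have l: "concat (map loop (lab p a)) \<in> lists P"
      using lab_lists[OF y(1)] loop_P by (auto, blast)
    have *: "T p @ [a] \<approx> concat (map loop (lab p a)) @ T a"
    proof -
      consider "lab p a = []" | z b where "z \<in> X" "p = src z b" "a = src z (\<not> b)"
        using lab_cases[OF y(1)] by blast
      then show ?thesis
      proof cases
        case 1
        then show ?thesis using T_tree y by simp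
      next
        case 2
        then show ?thesis using T_edge[of z b] lab_src[of z b] by simp
      qed
    qed
    have "(T p @ [a]) @ w \<approx> (concat (map loop (lab p a)) @ T a) @ w"
      by (intro word_cong_append word_cong_refl w *)
    also have "(concat (map loop (lab p a)) @ T a) @ w = concat (map loop (lab p a)) @ (T a @ w)" by simp
    also have "\<dots> \<approx> concat (map loop (lab p a)) @ (concat (map loop y) @ T q)"
      by (intro word_cong_append word_cong_refl l Cons.IH a w y)
    finally show ?thesis by (simp add: y(3))
  qed
qed

lemma loop_normal_form:
  assumes "w \<in> lists P" "run p0 w = Some (p0, x)"
  shows "p0 # w \<approx> loops x"
proof -
  have x: "x \<in> lists (X \<times> UNIV)" by (rule run_lists) fact
  then have c: "concat (map loop x) \<in> lists P" using loop_P by (auto, blast)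
  have "[p0] @ w \<approx> T p0 @ w"
    by (intro word_cong_append word_cong_refl word_cong_sym[OF T_p0] assms)
  also have "T p0 @ w \<approx> concat (map loop x) @ T p0"
    by (rule walk_normal_form[OF assms(1) p0_V assms(2)])
  also have "concat (map loop x) @ T p0 \<approx> concat (map loop x) @ [p0]"
    by (intro word_cong_append word_cong_refl T_p0 c)
  finally have *: "[p0] @ w \<approx> concat (map loop x) @ [p0]" .
  have p0: "[p0] \<in> lists P" using in_P p0_V by simp
  \<comment> \<open>One copy of \<open>p0\<close> is spent as the initial tree walk
    \<open>T p0\<close>; the other becomes the leading letter of \<open>loops x\<close>.\<close>
  have "[p0] @ w \<approx> [p0, p0] @ w"
    by (intro word_cong_append word_cong_refl word_cong_sym[OF rel_idem] assms in_P p0_V)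
  also have "[p0, p0] @ w = [p0] @ ([p0] @ w)" by simp
  also have "[p0] @ ([p0] @ w) \<approx> [p0] @ (concat (map loop x) @ [p0])"
    by (intro word_cong_append word_cong_refl * p0)
  also have "[p0] @ (concat (map loop x) @ [p0]) = loops x @ [p0]" by (simp add: loops_def)
  also have "loops x @ [p0] \<approx> loops x" by (rule loops_p0[OF x])
  finally show ?thesis by simp
qed



section \<open>The maximal subgroup\<close>

abbreviation cls :: "'a list \<Rightarrow> 'a list set" where
  "cls w \<equiv> word_cong P (PG_rels P m) `` {w}"

lemma PG_eq: "PG P m = {cls w | w. w \<in> lists P \<and> w \<noteq> []}"
  by (auto simp: PG_def presented_semigroup_def quotient_def)

lemma cls_PG: "w \<in> lists P \<Longrightarrow> w \<noteq> [] \<Longrightarrow> cls w \<in> PG P m"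
  by (auto simp: PG_eq)

lemma PG_mult_cls: "u \<in> lists P \<Longrightarrow> v \<in> lists P \<Longrightarrow> PG_mult P m (cls u) (cls v) = cls (u @ v)"
  by (simp add: PG_mult_def class_mult_classes)

lemma PG_closed: "x \<in> PG P m \<Longrightarrow> y \<in> PG P m \<Longrightarrow> PG_mult P m x y \<in> PG P m"
proof -
  assume "x \<in> PG P m" "y \<in> PG P m"
  then obtain u v where *: "x = cls u" "y = cls v" "u \<in> lists P" "v \<in> lists P" "u \<noteq> []"
    unfolding PG_eq by blast
  then have "u @ v \<in> lists P" "u @ v \<noteq> []" by auto
  then show ?thesis using * cls_PG[of "u @ v"] by (simp add: PG_mult_cls)
qed

lemma PG_assoc:
  "x \<in> PG P m \<Longrightarrow> y \<in> PG P m \<Longrightarrow> z \<in> PG P m \<Longrightarrow>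
    PG_mult P m (PG_mult P m x y) z = PG_mult P m x (PG_mult P m y z)"
proof -
  assume "x \<in> PG P m" "y \<in> PG P m" "z \<in> PG P m"
  then obtain u v w where *: "x = cls u" "y = cls v" "z = cls w" "u \<in> lists P" "v \<in> lists P" "w \<in> lists P"
    unfolding PG_eq by blast
  then have "u @ v \<in> lists P" "v @ w \<in> lists P" by auto
  then show ?thesis using * by (simp add: PG_mult_cls)
qed

lemma cls_eqI: "u \<approx> v \<Longrightarrow> cls u = cls v"
  by (rule equiv_class_eq[OF equiv_word_cong])

lemma cls_eqD: "cls u = cls v \<Longrightarrow> v \<in> lists P \<Longrightarrow> u \<approx> v"
  by (rule eq_equiv_class[OF _ equiv_word_cong])

text \<open>Allowing \<open>v\<close> to be empty treats the element itself and its multiples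
  alike.\<close>

lemma right_ideal_cls:
  assumes "u \<in> lists P" "Y \<in> insert (cls u) (PG_mult P m (cls u) ` PG P m)"
  obtains v where "v \<in> lists P" "Y = cls (u @ v)"
proof (cases "Y = cls u")
  case True
  then show thesis using that[of "[]"] by simp
next
  case False
  then obtain v where "v \<in> lists P" "Y = PG_mult P m (cls u) (cls v)"
    using assms(2) unfolding PG_eq by blast
  then show thesis using that[of v] PG_mult_cls[OF assms(1)] by simp
qed

lemma left_ideal_cls:
  assumes "u \<in> lists P" "Y \<in> insert (cls u) ((\<lambda>x. PG_mult P m x (cls u)) ` PG P m)"
  obtains v where "v \<in> lists P" "Y = cls (v @ u)"
proof (cases "Y = cls u")
  case True
  then show thesis using that[of "[]"] by simp
next
  case False
  then obtain v where "v \<in> lists P" "Y = PG_mult P m (cls v) (cls u)"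
    using assms(2) unfolding PG_eq by blast
  then show thesis using that[of v] PG_mult_cls[OF _ assms(1)] by simp
qed

lemma loops_inverse:
  assumes "u \<in> lists (X \<times> UNIV)"
  shows "loops u @ loops (inverse_word u) \<approx> [p0]"
proof -
  have "loops u @ loops (inverse_word u) \<approx> loops (u @ inverse_word u)"
    by (intro word_cong_sym[OF loops_append] assms inverse_word_lists)
  also have "loops (u @ inverse_word u) \<approx> loops []"
    by (intro loops_cong append_inverse_word assms)
  finally show ?thesis by (simp add: loops_def)
qed

text \<open>The words \<open>loops u\<close> are invertible relative to \<open>p0\<close>, which
  places them in the class. Conversely, an element of the class divides \<open>p0\<close>, so its
  walk from \<open>p0\<close> cannot fail, and it is fixed by \<open>p0\<close> on both sides, so
  the walk closes up and the normal form applies.\<close>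

lemma H_class_eq:
  "green_H (PG P m) (PG_mult P m) `` {cls [p0]} = {cls (loops u) | u. u \<in> lists (X \<times> UNIV)}"
proof (intro equalityI subsetI)
  have p0: "[p0] \<in> lists P" using p0_V in_P by simp
  fix Y assume "Y \<in> {cls (loops u) | u. u \<in> lists (X \<times> UNIV)}"
  then obtain u where u: "u \<in> lists (X \<times> UNIV)" "Y = cls (loops u)" by blast
  have P: "loops v \<in> lists P" "loops v \<noteq> []" "cls (loops v) \<in> PG P m" if "v \<in> lists (X \<times> UNIV)" for v
    using that loops_P[of v] cls_PG[of "loops v"] by (auto simp: loops_def)
  let ?v = "inverse_word u"
  have v: "?v \<in> lists (X \<times> UNIV)" by (rule inverse_word_lists) fact
  have 1: "cls (loops u) = PG_mult P m (cls [p0]) (cls (loops u))"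
    "cls (loops u) = PG_mult P m (cls (loops u)) (cls [p0])"
    unfolding PG_mult_cls[OF p0 P(1)[OF u(1)]] PG_mult_cls[OF P(1)[OF u(1)] p0]
    by (intro cls_eqI word_cong_sym[OF p0_loops] word_cong_sym[OF loops_p0] u)+
  have 2: "cls [p0] = PG_mult P m (cls (loops u)) (cls (loops ?v))"
    unfolding PG_mult_cls[OF P(1)[OF u(1)] P(1)[OF v]]
    by (intro cls_eqI word_cong_sym[OF loops_inverse] u)
  have 3: "cls [p0] = PG_mult P m (cls (loops ?v)) (cls (loops u))"
    unfolding PG_mult_cls[OF P(1)[OF v] P(1)[OF u(1)]]
    using word_cong_sym[OF loops_inverse[OF v]] by (intro cls_eqI) (simp add: inverse_word_involutive)
  have "(cls [p0], cls (loops u)) \<in> green_R (PG P m) (PG_mult P m)"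
    by (rule green_R_mutual[OF PG_assoc PG_closed _ _ _ _ 1(1) 2]) (use P u v cls_PG p0 in auto)
  moreover have "(cls [p0], cls (loops u)) \<in> green_L (PG P m) (PG_mult P m)"
    by (rule green_L_mutual[OF PG_assoc PG_closed _ _ _ _ 1(2) 3]) (use P u v cls_PG p0 in auto)
  ultimately show "Y \<in> green_H (PG P m) (PG_mult P m) `` {cls [p0]}"
    using u by (simp add: green_H_def)
next
  have p0: "[p0] \<in> lists P" using p0_V in_P by simp
  fix Y assume "Y \<in> green_H (PG P m) (PG_mult P m) `` {cls [p0]}"
  then have R: "(cls [p0], Y) \<in> green_R (PG P m) (PG_mult P m)"
    and L: "(cls [p0], Y) \<in> green_L (PG P m) (PG_mult P m)" by (auto simp: green_H_def)
  then obtain w where w: "w \<in> lists P" "w \<noteq> []" "Y = cls w"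
    by (auto simp: green_R_def PG_eq)
  have idem: "[p0, p0] \<approx> [p0]" using rel_idem in_P p0_V by simp
  have left: "[p0] @ w \<approx> w"
  proof -
    have "Y \<in> insert (cls [p0]) (PG_mult P m (cls [p0]) ` PG P m)"
      using R unfolding green_R_def by blast
    from right_ideal_cls[OF p0 this] obtain v where v: "v \<in> lists P" "Y = cls ([p0] @ v)" .
    then have v: "v \<in> lists P" "w \<approx> [p0] @ v"
      using cls_eqD[of w "[p0] @ v"] p0 w(3) by simp_all
    have "[p0] @ w \<approx> [p0] @ ([p0] @ v)"
      by (intro word_cong_append word_cong_refl v p0)
    also have "[p0] @ ([p0] @ v) = [p0, p0] @ v" by simp
    also have "[p0, p0] @ v \<approx> [p0] @ v"
      by (intro word_cong_append word_cong_refl v idem)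
    also have "[p0] @ v \<approx> w" by (rule word_cong_sym) fact
    finally show ?thesis .
  qed
  have right: "w @ [p0] \<approx> w"
  proof -
    have "Y \<in> insert (cls [p0]) ((\<lambda>x. PG_mult P m x (cls [p0])) ` PG P m)"
      using L unfolding green_L_def by blast
    from left_ideal_cls[OF p0 this] obtain v where v: "v \<in> lists P" "Y = cls (v @ [p0])" .
    then have v: "v \<in> lists P" "w \<approx> v @ [p0]"
      using cls_eqD[of w "v @ [p0]"] p0 w(3) by simp_all
    have "w @ [p0] \<approx> (v @ [p0]) @ [p0]"
      by (intro word_cong_append word_cong_refl v p0)
    also have "(v @ [p0]) @ [p0] = v @ [p0, p0]" by simp
    also have "v @ [p0, p0] \<approx> v @ [p0]"
      by (intro word_cong_append word_cong_refl v idem)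
    also have "v @ [p0] \<approx> w" by (rule word_cong_sym) fact
    finally show ?thesis .
  qed
  have "cls [p0] \<in> insert (cls w) (PG_mult P m (cls w) ` PG P m)"
    using R w(3) unfolding green_R_def by blast
  from right_ideal_cls[OF w(1) this] obtain v where v: "v \<in> lists P" "cls [p0] = cls (w @ v)" .
  then have v: "v \<in> lists P" "[p0] \<approx> w @ v"
    using cls_eqD[of "[p0]" "w @ v"] w(1) by simp_all
  \<comment> \<open>The reading of \<open>p0\<close> succeeds, hence so does that of
    \<open>w @ v\<close> and of its prefix \<open>w\<close>.\<close>
  have "run p0 [p0] = Some (p0, [])" using F_refl lab_refl p0_V e_V by auto
  then obtain z where "run p0 (w @ v) = Some (p0, z)"
    using run_cong_Some[OF v(2) p0_V] by blast
  then obtain q x where qx: "run p0 w = Some (q, x)"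
    by (auto simp: run_append split: option.splits)
  \<comment> \<open>The appended letter makes the reading end at \<open>p0\<close>, while
    \<open>w @ [p0] \<approx> w\<close> makes it end at \<open>q\<close>.\<close>
  then obtain y where "run p0 (w @ [p0]) = Some (q, y)"
    using run_cong_Some[OF word_cong_sym[OF right] p0_V] by blast
  then have "q = p0"
    using e_V p0_V by (auto simp: run_append qx split: if_splits)
  then have "p0 # w \<approx> loops x" using loop_normal_form[OF w(1)] qx by simp
  then have "w \<approx> loops x" using word_cong_trans[OF word_cong_sym[OF left]] by simp
  then have "Y = cls (loops x)" using w(3) cls_eqI by simp
  then show "Y \<in> {cls (loops u) | u. u \<in> lists (X \<times> UNIV)}" using run_lists[OF qx] by blast
qed

text \<open>The isomorphism starts from the free group, so the group axioms on the other side are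
  inherited by a homomorphic image.\<close>

theorem maximal_subgroup_free:
  defines "G \<equiv> maximal_subgroup (PG P m) (PG_mult P m) (PG_gen P m p0)"
  shows "group G \<and> free_group X \<cong> G"
proof -
  let ?L = "lists (X \<times> (UNIV :: bool set))" and ?C = "word_cong (X \<times> UNIV) (free_group_rels X)"
  \<comment> \<open>The union runs over representatives with equal values, which spares a
    choice.\<close>
  define h where "h Y = (\<Union>u\<in>Y. cls (loops u))" for Y
  have h: "h (?C `` {u}) = cls (loops u)" if "u \<in> ?L" for u
  proof -
    have "h (?C `` {u}) = (\<Union>v\<in>?C `` {u}. cls (loops u))"
      unfolding h_def by (intro SUP_cong refl cls_eqI loops_cong) (auto intro: word_cong_sym)
    moreover have "u \<in> ?C `` {u}" using word_cong_refl[OF that] by simp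
    ultimately show ?thesis by blast
  qed
  have el: "\<exists>u\<in>?L. Y = ?C `` {u}" if "Y \<in> carrier (free_group X)" for Y
    using that by (auto simp: free_group_def elim: quotientE)
  have cF: "carrier (free_group X) = (\<lambda>u. ?C `` {u}) ` ?L"
    by (auto simp: free_group_def quotient_def)
  have cG: "carrier G = {cls (loops u) | u. u \<in> ?L}"
    by (simp add: G_def maximal_subgroup_def PG_gen_def H_class_eq)
  have "(\<lambda>u. h (?C `` {u})) ` ?L = (\<lambda>u. cls (loops u)) ` ?L"
    by (intro image_cong refl h)
  then have onto: "h ` carrier (free_group X) = carrier G"
    unfolding cF cG image_image by (simp add: setcompr_eq_image)
  have inj: "inj_on h (carrier (free_group X))"
  proof (rule inj_onI)
    fix x y assume "x \<in> carrier (free_group X)" "y \<in> carrier (free_group X)" and eq: "h x = h y"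
    then obtain u v where *: "u \<in> ?L" "v \<in> ?L" "x = ?C `` {u}" "y = ?C `` {v}" using el by blast
    then have "loops u \<approx> loops v" using eq cls_eqD loops_P by (simp add: h)
    then show "x = y" using * by (simp add: cong_loops_iff word_cong_class_eq_iff)
  qed
  have hom: "h \<in> hom (free_group X) G"
  proof (rule homI)
    fix x y assume "x \<in> carrier (free_group X)" "y \<in> carrier (free_group X)"
    then obtain u v where *: "u \<in> ?L" "v \<in> ?L" "x = ?C `` {u}" "y = ?C `` {v}" using el by blast
    then have uv: "u @ v \<in> ?L" by simp
    have "h (mult (free_group X) x y) = cls (loops (u @ v))"
      using * h[OF uv] by (simp add: free_group_def class_mult_classes)
    also have "\<dots> = cls (loops u @ loops v)" by (intro cls_eqI loops_append *)
    also have "\<dots> = mult G (h x) (h y)"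
      using * loops_P by (simp add: h G_def maximal_subgroup_def PG_mult_cls)
    finally show "h (mult (free_group X) x y) = mult G (h x) (h y)" .
  qed (use onto in blast)
  have "h (one (free_group X)) = one G"
    using h[of "[]"] by (simp add: free_group_def G_def maximal_subgroup_def PG_gen_def loops_def)
  then have "G\<lparr>carrier := h ` carrier (free_group X), one := h (one (free_group X))\<rparr> = G"
    unfolding onto by (simp add: G_def maximal_subgroup_def)
  then have "group G"
    using group.hom_imp_img_group[OF group_free_group hom] by simp
  moreover have "h \<in> iso (free_group X) G"
    unfolding iso_def using hom inj onto by (simp add: bij_betw_def)
  ultimately show ?thesis by (auto simp: is_iso_def)
qed

end


section \<open>Diagrams as fibres of labellings\<close>

fun idx :: "vertex \<Rightarrow> nat" where
  "idx (Top k) = k"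
| "idx (Mid k) = k"
| "idx (Bot k) = k"

lemma in_vertices: "x \<in> vertices n \<longleftrightarrow> (\<exists>k\<in>{1..n}. x = Top k \<or> x = Bot k)"
  by (auto simp: vertices_def top_vertices_def bot_vertices_def)

lemma Top_vertices [simp]: "Top k \<in> vertices n \<longleftrightarrow> k \<in> {1..n}"
  and Bot_vertices [simp]: "Bot k \<in> vertices n \<longleftrightarrow> k \<in> {1..n}"
  and Mid_vertices [simp]: "Mid k \<notin> vertices n"
  by (auto simp: in_vertices)

lemma finite_vertices: "finite (vertices n)"
  by (simp add: vertices_def top_vertices_def bot_vertices_def)

lemma block_graph_quotient: "equiv A R \<Longrightarrow> block_graph (A // R) = R"
  unfolding block_graph_def quotient_def
  by (auto simp: equiv_def refl_on_def dest: symD transD)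

lemma equiv_block_graph: "a \<in> partition_monoid n \<Longrightarrow> equiv (vertices n) (block_graph a)"
  using equiv_partition_on[of "vertices n" a] by (simp add: partition_monoid_def block_graph_def)

lemma quotient_block_graph: "a \<in> partition_monoid n \<Longrightarrow> vertices n // block_graph a = a"
  using partition_on_eq_quotient[of "vertices n" a] by (simp add: partition_monoid_def block_graph_def)

lemma diagram_eqI:
  "a \<in> partition_monoid n \<Longrightarrow> b \<in> partition_monoid n \<Longrightarrow> block_graph a = block_graph b \<Longrightarrow> a = b"
  using quotient_block_graph by metis

lemma block_graph_vertices:
  "a \<in> partition_monoid n \<Longrightarrow> (x, y) \<in> block_graph a \<Longrightarrow> x \<in> vertices n \<and> y \<in> vertices n"
  using equiv_block_graph equiv_type by blast

lemma block_graph_refl: "a \<in> partition_monoid n \<Longrightarrow> x \<in> vertices n \<Longrightarrow> (x, x) \<in> block_graph a"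
  using equiv_block_graph by (meson equivE refl_onD)

lemma block_graph_sym: "(x, y) \<in> block_graph a \<Longrightarrow> (y, x) \<in> block_graph a"
  by (auto simp: block_graph_def)

lemma block_graph_trans:
  "a \<in> partition_monoid n \<Longrightarrow> (x, y) \<in> block_graph a \<Longrightarrow> (y, z) \<in> block_graph a \<Longrightarrow> (x, z) \<in> block_graph a"
  using equiv_block_graph by (meson equivE transD)

text \<open>A diagram is presented as the kernel of a labelling of its vertices; equality, star and
  products then come down to computing labels.\<close>

definition fibres :: "nat \<Rightarrow> (vertex \<Rightarrow> 'l) \<Rightarrow> diagram" where
  "fibres n f = vertices n // {(x, y). x \<in> vertices n \<and> y \<in> vertices n \<and> f x = f y}"

lemma equiv_fibres: "equiv (vertices n) {(x, y). x \<in> vertices n \<and> y \<in> vertices n \<and> f x = f y}"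
  by (rule equivI) (auto simp: refl_on_def sym_def trans_def)

lemma block_graph_fibres:
  "block_graph (fibres n f) = {(x, y). x \<in> vertices n \<and> y \<in> vertices n \<and> f x = f y}"
  unfolding fibres_def by (rule block_graph_quotient) (rule equiv_fibres)

lemma fibres_partition_monoid: "fibres n f \<in> partition_monoid n"
  by (simp add: fibres_def partition_monoid_def partition_on_quotient equiv_fibres)

lemma fibres_eqI:
  "(\<And>x y. x \<in> vertices n \<Longrightarrow> y \<in> vertices n \<Longrightarrow> f x = f y \<longleftrightarrow> g x = g y) \<Longrightarrow> fibres n f = fibres n g"
  unfolding fibres_def by (intro arg_cong2[of _ _ _ _ "(//)"] refl) auto

text \<open>The label of a vertex is a chosen member of its own block. Labels that are themselves
  connected vertices are what the premise \<open>conn\<close> of \<open>pmult_eq_fibres\<close> asks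
  for.\<close>

lemma fibres_exists:
  assumes "a \<in> partition_monoid n"
  obtains f where "a = fibres n f" "\<And>x. x \<in> vertices n \<Longrightarrow> (x, f x) \<in> block_graph a"
proof -
  define f where "f x = (SOME y. (x, y) \<in> block_graph a)" for x
  have f: "(x, f x) \<in> block_graph a" if "x \<in> vertices n" for x
    unfolding f_def by (rule someI) (rule block_graph_refl[OF assms that])
  have "f x = f y" if "(x, y) \<in> block_graph a" for x y
  proof -
    have "(x, z) \<in> block_graph a \<longleftrightarrow> (y, z) \<in> block_graph a" for z
      using that block_graph_sym block_graph_trans[OF assms] by blast
    then show ?thesis by (simp add: f_def)
  qed
  moreover have "(x, y) \<in> block_graph a" if "x \<in> vertices n" "y \<in> vertices n" "f x = f y" for x y
    using block_graph_trans[OF assms f[OF that(1)]] block_graph_sym[OF f[OF that(2)]] that(3) by simp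
  ultimately have "block_graph a = block_graph (fibres n f)"
    using block_graph_vertices[OF assms] unfolding block_graph_fibres by blast
  then show ?thesis using that f diagram_eqI[OF assms fibres_partition_monoid] by blast
qed


section \<open>Products\<close>

lemma product_graphI1: "(x, y) \<in> block_graph a \<Longrightarrow> (bot_to_mid x, bot_to_mid y) \<in> product_graph a b"
  by (auto simp: product_graph_def)

lemma product_graphI2: "(x, y) \<in> block_graph b \<Longrightarrow> (top_to_mid x, top_to_mid y) \<in> product_graph a b"
  by (auto simp: product_graph_def)

lemma product_graph_cases:
  assumes "(u, v) \<in> product_graph a b"
  obtains x y where "(x, y) \<in> block_graph a" "u = bot_to_mid x" "v = bot_to_mid y"
    | x y where "(x, y) \<in> block_graph b" "u = top_to_mid x" "v = top_to_mid y"
  using assms by (auto simp: product_graph_def)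

lemma equiv_pmult: "equiv (vertices n) ((product_graph a b)\<^sup>* \<inter> vertices n \<times> vertices n)"
proof (rule equivI)
  have "sym (product_graph a b)"
    by (auto simp: sym_def product_graph_def intro: block_graph_sym)
  then have "sym ((product_graph a b)\<^sup>*)" by (rule sym_rtrancl)
  then show "sym ((product_graph a b)\<^sup>* \<inter> vertices n \<times> vertices n)" by (auto simp: sym_def)
  show "trans ((product_graph a b)\<^sup>* \<inter> vertices n \<times> vertices n)"
    by (auto intro!: transI elim: rtrancl_trans)
qed (auto simp: refl_on_def)

lemma block_graph_pmult:
  "block_graph (pmult n a b) = (product_graph a b)\<^sup>* \<inter> vertices n \<times> vertices n"
  unfolding pmult_def by (rule block_graph_quotient) (rule equiv_pmult)

lemma pmult_partition_monoid: "pmult n a b \<in> partition_monoid n"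
  by (simp add: pmult_def partition_monoid_def partition_on_quotient equiv_pmult)

lemma rtrancl_closed:
  assumes "(x, y) \<in> R\<^sup>*" "x \<in> S" "\<And>u v. u \<in> S \<Longrightarrow> (u, v) \<in> R \<Longrightarrow> v \<in> S"
  shows "y \<in> S"
  using assms(1) by induction (use assms in auto)

text \<open>The labelling \<open>g\<close> also covers the middle row. Being constant along the
  edges of both factors, it cannot separate connected vertices; and as each outer vertex is
  connected to the vertex that serves as its label, equal labels imply connectedness.\<close>

lemma pmult_eq_fibres:
  assumes left: "\<And>x y. (x, y) \<in> block_graph a \<Longrightarrow> g (bot_to_mid x) = g (bot_to_mid y)"
    and right: "\<And>x y. (x, y) \<in> block_graph b \<Longrightarrow> g (top_to_mid x) = g (top_to_mid y)"
    and conn: "\<And>x. x \<in> vertices n \<Longrightarrow> (x, g x) \<in> (product_graph a b)\<^sup>*"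
  shows "pmult n a b = fibres n g"
proof (rule diagram_eqI[OF pmult_partition_monoid fibres_partition_monoid])
  have sym: "sym ((product_graph a b)\<^sup>*)"
    by (rule sym_rtrancl) (auto simp: sym_def product_graph_def intro: block_graph_sym)
  have inv: "g x = g y" if "(x, y) \<in> (product_graph a b)\<^sup>*" for x y
    using that by induction (use left right in \<open>auto elim: product_graph_cases\<close>)
  have "(x, y) \<in> (product_graph a b)\<^sup>*" if "x \<in> vertices n" "y \<in> vertices n" "g x = g y" for x y
    using conn[OF that(1)] symD[OF sym conn[OF that(2)]] that(3) by (simp add: rtrancl_trans)
  then show "block_graph (pmult n a b) = block_graph (fibres n g)"
    using inv by (auto simp: block_graph_pmult block_graph_fibres)
qed

lemma pmult_tops:
  assumes "a \<in> partition_monoid n" "(Top i, Top j) \<in> block_graph a"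
  shows "(Top i, Top j) \<in> block_graph (pmult n a b)"
  using product_graphI1[OF assms(2), of b] block_graph_vertices[OF assms] by (auto simp: block_graph_pmult)

lemma pmult_bots:
  assumes "b \<in> partition_monoid n" "(Bot i, Bot j) \<in> block_graph b"
  shows "(Bot i, Bot j) \<in> block_graph (pmult n a b)"
  using product_graphI2[OF assms(2), of a] block_graph_vertices[OF assms] by (auto simp: block_graph_pmult)

lemma bot_to_mid_Top: "bot_to_mid x = Top k \<longleftrightarrow> x = Top k"
  and top_to_mid_Bot: "top_to_mid x = Bot k \<longleftrightarrow> x = Bot k"
  and bot_to_mid_not_Bot: "bot_to_mid x \<noteq> Bot k"
  and top_to_mid_not_Top: "top_to_mid x \<noteq> Top k"
  by (cases x; auto)+

text \<open>A block of \<open>a\<close> inside the top row has no edge to the middle row, so nothing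
  in \<open>b\<close> can enlarge it.\<close>

lemma pmult_top_closed:
  assumes a: "a \<in> partition_monoid n" and k: "\<forall>k. (Top j, Bot k) \<notin> block_graph a"
    and "(Top j, y) \<in> block_graph (pmult n a b)"
  shows "(Top j, y) \<in> block_graph a"
proof -
  have "(Top j, y) \<in> (product_graph a b)\<^sup>*" "Top j \<in> vertices n"
    using assms by (auto simp: block_graph_pmult)
  from this(1) have "y \<in> {y. (Top j, y) \<in> block_graph a}"
  proof (rule rtrancl_closed)
    fix u v assume u: "u \<in> {y. (Top j, y) \<in> block_graph a}" and uv: "(u, v) \<in> product_graph a b"
    obtain l where l: "u = Top l"
      using k u block_graph_vertices[OF a, of "Top j" u] by (auto simp: in_vertices)
    from uv show "v \<in> {y. (Top j, y) \<in> block_graph a}"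
    proof (cases rule: product_graph_cases)
      case (1 x z)
      then have "x = Top l" using l bot_to_mid_Top[of x l] by simp
      then have z: "(Top j, z) \<in> block_graph a"
        using u l 1(1) block_graph_trans[OF a, of "Top j" "Top l" z] by simp
      moreover obtain i where "z = Top i"
        using k z block_graph_vertices[OF a, of "Top j" z] by (auto simp: in_vertices)
      ultimately show ?thesis using 1 by simp
    next
      case (2 x z)
      then show ?thesis using l top_to_mid_not_Top[of x l] by simp
    qed
  qed (use block_graph_refl[OF a] \<open>Top j \<in> vertices n\<close> in auto)
  then show ?thesis by simp
qed

lemma pmult_bot_closed:
  assumes b: "b \<in> partition_monoid n" and k: "\<forall>k. (Bot j, Top k) \<notin> block_graph b"
    and "(Bot j, y) \<in> block_graph (pmult n a b)"
  shows "(Bot j, y) \<in> block_graph b"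
proof -
  have "(Bot j, y) \<in> (product_graph a b)\<^sup>*" "Bot j \<in> vertices n"
    using assms by (auto simp: block_graph_pmult)
  from this(1) have "y \<in> {y. (Bot j, y) \<in> block_graph b}"
  proof (rule rtrancl_closed)
    fix u v assume u: "u \<in> {y. (Bot j, y) \<in> block_graph b}" and uv: "(u, v) \<in> product_graph a b"
    obtain l where l: "u = Bot l"
      using k u block_graph_vertices[OF b, of "Bot j" u] by (auto simp: in_vertices)
    from uv show "v \<in> {y. (Bot j, y) \<in> block_graph b}"
    proof (cases rule: product_graph_cases)
      case (2 x z)
      then have "x = Bot l" using l top_to_mid_Bot[of x l] by simp
      then have z: "(Bot j, z) \<in> block_graph b"
        using u l 2(1) block_graph_trans[OF b, of "Bot j" "Bot l" z] by simp
      moreover obtain i where "z = Bot i"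
        using k z block_graph_vertices[OF b, of "Bot j" z] by (auto simp: in_vertices)
      ultimately show ?thesis using 2 by simp
    next
      case (1 x z)
      then show ?thesis using l bot_to_mid_not_Bot[of x l] by simp
    qed
  qed (use block_graph_refl[OF b] \<open>Bot j \<in> vertices n\<close> in auto)
  then show ?thesis by simp
qed


section \<open>The star operation\<close>

lemma flip_flip [simp]: "flip (flip x) = x"
  by (cases x) auto

lemma inj_flip: "inj flip"
  by (rule inj_on_inverseI[of _ flip]) simp

lemma flip_vertices [simp]: "flip x \<in> vertices n \<longleftrightarrow> x \<in> vertices n"
  by (cases x) auto

lemma block_graph_star: "(x, y) \<in> block_graph (star a) \<longleftrightarrow> (flip x, flip y) \<in> block_graph a"
proof -
  have "x \<in> flip ` B \<longleftrightarrow> flip x \<in> B" for x B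
    using image_eqI[of x flip "flip x" B] by auto
  then show ?thesis by (auto simp: star_def block_graph_def)
qed

lemma star_partition_monoid: "a \<in> partition_monoid n \<Longrightarrow> star a \<in> partition_monoid n"
proof -
  assume "a \<in> partition_monoid n"
  then have "partition_on (flip ` vertices n) ((`) flip ` a - {{}})"
    using partition_on_inj_image[OF _ inj_on_subset[OF inj_flip]] by (simp add: partition_monoid_def)
  moreover have "flip ` vertices n = vertices n"
    using image_eqI[of _ flip "flip _"] by (auto 0 3 simp: image_iff intro: bexI[of _ "flip _"])
  moreover have "(`) flip ` a - {{}} = star a"
    using \<open>a \<in> _\<close> by (auto simp: star_def partition_monoid_def partition_on_def)
  ultimately show ?thesis by (simp add: partition_monoid_def)
qed

lemma star_fibres: "star (fibres n f) = fibres n (f \<circ> flip)"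
  by (rule diagram_eqI[OF star_partition_monoid fibres_partition_monoid])
    (auto simp: fibres_partition_monoid block_graph_star block_graph_fibres)


section \<open>Projections of large rank\<close>

text \<open>\<^term>\<open>pr n {}\<close> is the identity, and \<^term>\<open>pr n {i}\<close> cuts the string \<^term>\<open>i\<close>, while \<^term>\<open>pr n {i, j}\<close>
  joins the strings \<^term>\<open>i\<close> and \<^term>\<open>j\<close>.\<close>

definition lbl :: "nat set \<Rightarrow> vertex \<Rightarrow> vertex" where
  "lbl A v = (if A = {idx v} then v else if idx v \<in> A then Mid (Min A) else Mid (idx v))"

definition pr :: "nat \<Rightarrow> nat set \<Rightarrow> diagram" where
  "pr n A = fibres n (lbl A)"

text \<open>\<open>lbl\<close> names the joined block by the minimum; this variant merges
  \<open>i\<close> into \<open>j\<close> whichever is smaller, so either end of a pair can be the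
  cut one. The values lie in the middle row, where they can be reached inside a product
  graph.\<close>

definition join_lbl :: "nat \<Rightarrow> nat \<Rightarrow> vertex \<Rightarrow> vertex" where
  "join_lbl i j v = Mid (if idx v = i then j else idx v)"

lemma pr_empty: "pr n {} = fibres n (\<lambda>v. Mid (idx v))"
  unfolding pr_def by (rule fibres_eqI) (simp add: lbl_def)

lemma pr_join: "i \<noteq> j \<Longrightarrow> pr n {i, j} = fibres n (join_lbl i j)"
  unfolding pr_def by (rule fibres_eqI) (auto simp: lbl_def join_lbl_def min_def)

lemma point_lbl [simp]:
  "lbl {i} (Top k) = (if k = i then Top i else Mid k)"
  "lbl {i} (Bot k) = (if k = i then Bot i else Mid k)"
  "lbl {i} (Mid k) = Mid k"
  by (auto simp: lbl_def)

lemma join_lbl [simp]: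
  "join_lbl i j (Top k) = Mid (if k = i then j else k)"
  "join_lbl i j (Bot k) = Mid (if k = i then j else k)"
  "join_lbl i j (Mid k) = Mid (if k = i then j else k)"
  by (auto simp: join_lbl_def)

lemma pr_partition_monoid [simp]: "pr n A \<in> partition_monoid n"
  by (simp add: pr_def fibres_partition_monoid)

lemma small_set_cases:
  fixes A :: "nat set"
  assumes "card A \<le> 2" "finite A"
  obtains "A = {}" | i where "A = {i}" | i j where "A = {i, j}" "i < j"
proof -
  consider "card A = 0" | "card A = 1" | "card A = 2" using assms(1) by linarith
  then show ?thesis
  proof cases
    case 3
    then obtain i j where "A = {i, j}" "i \<noteq> j" by (auto simp: card_2_iff)
    then show ?thesis using that(3)[of i j] that(3)[of j i] by (cases "i < j") auto
  qed (use assms that in \<open>auto simp: card_1_singleton_iff\<close>)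
qed

lemma block_graph_pr:
  assumes "card A \<le> 2" "finite A"
  shows "(x, y) \<in> block_graph (pr n A) \<longleftrightarrow> x \<in> vertices n \<and> y \<in> vertices n \<and>
    (x = y \<or> idx x = idx y \<and> A \<noteq> {idx x} \<or> idx x \<noteq> idx y \<and> A = {idx x, idx y})"
  using small_set_cases[OF assms]
proof cases
  case 1
  then show ?thesis by (auto simp: pr_def block_graph_fibres lbl_def)
next
  case (2 i)
  have "x \<in> vertices n \<Longrightarrow> x \<noteq> Mid k" for x k by auto
  then show ?thesis using 2
    by (auto simp: pr_def block_graph_fibres lbl_def; metis idx.simps)
next
  case (3 i j)
  then show ?thesis
    by (auto simp: pr_def block_graph_fibres lbl_def doubleton_eq_iff)
qed

lemma pr_Top_Bot: "card A \<le> 2 \<Longrightarrow> finite A \<Longrightarrow> i \<in> {1..n} \<Longrightarrow> (Top i, Bot i) \<in> block_graph (pr n A) \<longleftrightarrow> A \<noteq> {i}"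
  by (simp add: block_graph_pr)

lemma pr_Top_Top:
  "card A \<le> 2 \<Longrightarrow> finite A \<Longrightarrow> i \<in> {1..n} \<Longrightarrow> j \<in> {1..n} \<Longrightarrow> i \<noteq> j \<Longrightarrow>
    (Top i, Top j) \<in> block_graph (pr n A) \<longleftrightarrow> A = {i, j}"
  by (simp add: block_graph_pr)

text \<open>The set can be read off the diagram: a cut string separates \<open>Top i\<close> from
  \<open>Bot i\<close>, and a pair puts two top vertices in one block.\<close>

lemma pr_inj:
  assumes A: "A \<subseteq> {1..n}" "card A \<le> 2" and B: "B \<subseteq> {1..n}" "card B \<le> 2" and eq: "pr n A = pr n B"
  shows "A = B"
proof -
  have fin: "finite A" "finite B" by (rule finite_subset, rule A B, simp)+
  have point: "D = {i}" if "i \<in> {1..n}" "finite D" "card D \<le> 2" "pr n {i} = pr n D" for D i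
  proof -
    have "(Top i, Bot i) \<notin> block_graph (pr n {i})"
      using pr_Top_Bot[OF _ _ that(1), of "{i}"] by simp
    then show ?thesis unfolding that(4) using pr_Top_Bot[OF that(3,2,1)] by blast
  qed
  have join: "D = {i, j}" if "i \<in> {1..n}" "j \<in> {1..n}" "i \<noteq> j" "finite D" "card D \<le> 2"
    "pr n {i, j} = pr n D" for D i j
  proof -
    have "(Top i, Top j) \<in> block_graph (pr n {i, j})"
      using pr_Top_Top[OF _ _ that(1-3), of "{i, j}"] that(3) by simp
    then show ?thesis unfolding that(6) using pr_Top_Top[OF that(5,4,1-3)] by blast
  qed
  from A(2) fin(1) show ?thesis
  proof (cases rule: small_set_cases)
    case 1
    from B(2) fin(2) show ?thesis
    proof (cases rule: small_set_cases)
      case (2 i)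
      then show ?thesis using point[OF _ fin(1) A(2) eq[symmetric, unfolded 2]] B(1) by simp
    next
      case (3 i j)
      then show ?thesis using join[OF _ _ _ fin(1) A(2) eq[symmetric, unfolded 3(1)]] B(1) by simp
    qed (use 1 in simp)
  next
    case (2 i)
    then show ?thesis using point[OF _ fin(2) B(2) eq[unfolded 2]] A(1) by simp
  next
    case (3 i j)
    then show ?thesis using join[OF _ _ _ fin(2) B(2) eq[unfolded 3(1)]] A(1) by simp
  qed
qed

lemma idx_flip [simp]: "idx (flip v) = idx v"
  by (cases v) auto

lemma star_pr: "star (pr n A) = pr n A"
proof -
  have 1: "lbl A (flip v) = (if A = {idx v} then flip v else lbl A v)" for v
    by (simp add: lbl_def)
  have 2: "lbl A v = v" if "A = {idx v}" for v using that by (simp add: lbl_def)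
  have 3: "lbl A v \<notin> vertices n" if "A \<noteq> {idx v}" for v using that by (simp add: lbl_def)
  have "lbl A (flip x) = lbl A (flip y) \<longleftrightarrow> lbl A x = lbl A y" if xy: "x \<in> vertices n" "y \<in> vertices n" for x y
  proof (cases "A = {idx x}"; cases "A = {idx y}")
    assume "A = {idx x}" "A = {idx y}"
    then show ?thesis using inj_eq[OF inj_flip] by (metis 1 2)
  next
    assume *: "A = {idx x}" "A \<noteq> {idx y}"
    then show ?thesis using 3[OF *(2)] xy by (metis 1 2 flip_vertices)
  next
    assume *: "A \<noteq> {idx x}" "A = {idx y}"
    then show ?thesis using 3[OF *(1)] xy by (metis 1 2 flip_vertices)
  qed (simp add: 1)
  then show ?thesis unfolding pr_def star_fibres by (intro fibres_eqI) simp
qed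

section \<open>Products with the identity, and products of cuts with joins\<close>

lemma pmult_id_left:
  assumes "q \<in> partition_monoid n"
  shows "pmult n (pr n {}) q = q"
proof -
  obtain f where f: "q = fibres n f" "\<And>x. x \<in> vertices n \<Longrightarrow> (x, f x) \<in> block_graph q"
    using fibres_exists[OF assms] by blast
  \<comment> \<open>A middle vertex takes the label of the top vertex of \<open>q\<close> that was
    renamed to it; \<open>top_to_mid\<close> then moves the label itself into the product
    graph.\<close>
  define mt where "mt v = (case v of Mid k \<Rightarrow> Top k | _ \<Rightarrow> v)" for v
  have "pmult n (pr n {}) q = fibres n (\<lambda>v. top_to_mid (f (mt v)))"
  proof (rule pmult_eq_fibres)
    fix x assume x: "x \<in> vertices n"
    have "(x, top_to_mid x) \<in> (product_graph (pr n {}) q)\<^sup>*"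
    proof (cases x)
      case (Top k)
      then have "(Top k, Bot k) \<in> block_graph (pr n {})" using x by (simp add: pr_empty block_graph_fibres)
      then show ?thesis using product_graphI1 Top by fastforce
    qed auto
    also have "(top_to_mid x, top_to_mid (f x)) \<in> product_graph (pr n {}) q"
      using f(2)[OF x] by (rule product_graphI2)
    finally show "(x, top_to_mid (f (mt x))) \<in> (product_graph (pr n {}) q)\<^sup>*"
      using x by (auto simp: mt_def in_vertices)
  qed (auto simp: f(1) pr_empty block_graph_fibres mt_def in_vertices)
  also have "\<dots> = fibres n f"
  proof (rule fibres_eqI)
    fix x y assume xy: "x \<in> vertices n" "y \<in> vertices n"
    have "mt x = x" "mt y = y" using xy by (auto simp: mt_def in_vertices)
    moreover have "f x \<in> vertices n" "f y \<in> vertices n"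
      using f(2) xy block_graph_vertices[OF assms] by blast+
    ultimately show "top_to_mid (f (mt x)) = top_to_mid (f (mt y)) \<longleftrightarrow> f x = f y"
      by (auto simp: in_vertices)
  qed
  finally show ?thesis using f(1) by simp
qed

lemma pmult_id_right:
  assumes "q \<in> partition_monoid n"
  shows "pmult n q (pr n {}) = q"
proof -
  obtain f where f: "q = fibres n f" "\<And>x. x \<in> vertices n \<Longrightarrow> (x, f x) \<in> block_graph q"
    using fibres_exists[OF assms] by blast
  define mb where "mb v = (case v of Mid k \<Rightarrow> Bot k | _ \<Rightarrow> v)" for v
  have "pmult n q (pr n {}) = fibres n (\<lambda>v. bot_to_mid (f (mb v)))"
  proof (rule pmult_eq_fibres)
    fix x assume x: "x \<in> vertices n"
    have "(x, bot_to_mid x) \<in> (product_graph q (pr n {}))\<^sup>*"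
    proof (cases x)
      case (Bot k)
      then have "(Bot k, Top k) \<in> block_graph (pr n {})" using x by (simp add: pr_empty block_graph_fibres)
      then show ?thesis using product_graphI2 Bot by fastforce
    qed auto
    also have "(bot_to_mid x, bot_to_mid (f x)) \<in> product_graph q (pr n {})"
      using f(2)[OF x] by (rule product_graphI1)
    finally show "(x, bot_to_mid (f (mb x))) \<in> (product_graph q (pr n {}))\<^sup>*"
      using x by (auto simp: mb_def in_vertices)
  qed (auto simp: f(1) pr_empty block_graph_fibres mb_def in_vertices)
  also have "\<dots> = fibres n f"
  proof (rule fibres_eqI)
    fix x y assume xy: "x \<in> vertices n" "y \<in> vertices n"
    have "mb x = x" "mb y = y" using xy by (auto simp: mb_def in_vertices)
    moreover have "f x \<in> vertices n" "f y \<in> vertices n"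
      using f(2) xy block_graph_vertices[OF assms] by blast+
    ultimately show "bot_to_mid (f (mb x)) = bot_to_mid (f (mb y)) \<longleftrightarrow> f x = f y"
      by (auto simp: in_vertices)
  qed
  finally show ?thesis using f(1) by simp
qed

lemma product_graph_step:
  assumes "(x, y) \<in> block_graph a \<and> u = bot_to_mid x \<and> v = bot_to_mid y \<or>
    (x, y) \<in> block_graph b \<and> u = top_to_mid x \<and> v = top_to_mid y"
  shows "(u, v) \<in> (product_graph a b)\<^sup>*"
  using assms product_graphI1[of x y a b] product_graphI2[of x y b a] by auto

lemma idem_point: "pmult n (pr n {i}) (pr n {i}) = pr n {i}"
  unfolding pr_def
proof (rule pmult_eq_fibres)
  fix x assume "x \<in> vertices n"
  then show "(x, lbl {i} x) \<in> (product_graph (fibres n (lbl {i})) (fibres n (lbl {i})))\<^sup>*"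
    \<comment> \<open>The second argument is the member of the block of \<open>x\<close>, in the
      factor containing \<open>x\<close>, whose renaming is the label; a cut vertex is taken
      itself.\<close>
    by (intro product_graph_step[of x "if idx x = i then x else case x of Top k \<Rightarrow> Bot k | Bot k \<Rightarrow> Top k | _ \<Rightarrow> x"])
      (auto simp: in_vertices lbl_def block_graph_fibres)
qed (auto simp: in_vertices lbl_def block_graph_fibres)


context
  fixes n i j :: nat
  assumes ij: "i \<in> {1..n}" "j \<in> {1..n}" "i \<noteq> j"
begin

lemma idem_join: "pmult n (pr n {i, j}) (pr n {i, j}) = pr n {i, j}"
  unfolding pr_join[OF ij(3)]
proof (rule pmult_eq_fibres)
  fix x assume "x \<in> vertices n"
  then show "(x, join_lbl i j x) \<in> (product_graph (fibres n (join_lbl i j)) (fibres n (join_lbl i j)))\<^sup>*"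
    using ij by (intro product_graph_step[of x "case x of Top k \<Rightarrow> Bot (if k = i then j else k) | Bot k \<Rightarrow> Top (if k = i then j else k) | _ \<Rightarrow> x"])
      (auto simp: in_vertices block_graph_fibres split: if_splits)
qed (auto simp: in_vertices block_graph_fibres split: if_splits)

text \<open>Labels the cut at \<open>i\<close> followed by the join of \<open>i\<close> and
  \<open>j\<close>: \<open>Top i\<close> is isolated, while \<open>Bot i\<close> stays in the block
  of \<open>j\<close>.\<close>

definition cut_join :: "vertex \<Rightarrow> vertex" where
  "cut_join v = (if v = Top i then v else join_lbl i j v)"

definition join_cut :: "vertex \<Rightarrow> vertex" where
  "join_cut v = (if v = Bot i then v else join_lbl i j v)"

lemma pmult_point_join: "pmult n (pr n {i}) (pr n {i, j}) = fibres n cut_join"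
  unfolding pr_join[OF ij(3)] pr_def[of n "{i}"]
proof (rule pmult_eq_fibres)
  fix x assume "x \<in> vertices n"
  then show "(x, cut_join x) \<in> (product_graph (fibres n (lbl {i})) (fibres n (join_lbl i j)))\<^sup>*"
    using ij by (intro product_graph_step[of x "case x of Top k \<Rightarrow> if k = i then x else Bot k | Bot k \<Rightarrow> Top (if k = i then j else k) | _ \<Rightarrow> x"])
      (auto simp: in_vertices cut_join_def  block_graph_fibres split: if_splits)
qed (auto simp: in_vertices cut_join_def  block_graph_fibres split: if_splits)

lemma pmult_join_point: "pmult n (pr n {i, j}) (pr n {i}) = fibres n join_cut"
  unfolding pr_join[OF ij(3)] pr_def[of n "{i}"]
proof (rule pmult_eq_fibres)
  fix x assume "x \<in> vertices n"
  then show "(x, join_cut x) \<in> (product_graph (fibres n (join_lbl i j)) (fibres n (lbl {i})))\<^sup>*"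
    using ij by (intro product_graph_step[of x "case x of Bot k \<Rightarrow> if k = i then x else Top k | Top k \<Rightarrow> Bot (if k = i then j else k) | _ \<Rightarrow> x"])
      (auto simp: in_vertices join_cut_def  block_graph_fibres split: if_splits)
qed (auto simp: in_vertices join_cut_def  block_graph_fibres split: if_splits)

lemma sandwich_point_join: "pmult n (pmult n (pr n {i}) (pr n {i, j})) (pr n {i}) = pr n {i}"
proof -
  \<comment> \<open>\<open>g\<close> differs from \<open>lbl {i}\<close> only at
    \<open>Mid i\<close>, which the left factor joins to \<open>j\<close>; on the outer rows this is
    invisible.\<close>
  define g where "g v = (if v = Top i \<or> v = Bot i then v else join_lbl i j v)" for v
  have "pmult n (fibres n cut_join) (fibres n (lbl {i})) = fibres n g"
  proof (rule pmult_eq_fibres)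
    fix x assume "x \<in> vertices n"
    then show "(x, g x) \<in> (product_graph (fibres n cut_join) (fibres n (lbl {i})))\<^sup>*"
      using ij by (intro product_graph_step[of x "case x of Bot k \<Rightarrow> if k = i then x else Top k | Top k \<Rightarrow> if k = i then x else Bot k | _ \<Rightarrow> x"])
        (auto simp: in_vertices cut_join_def g_def  block_graph_fibres split: if_splits)
  qed (auto simp: in_vertices cut_join_def g_def  block_graph_fibres split: if_splits)
  also have "\<dots> = fibres n (lbl {i})"
    by (rule fibres_eqI) (auto simp: in_vertices g_def  join_lbl_def split: if_splits)
  finally show ?thesis unfolding pmult_point_join by (simp add: pr_def)
qed

lemma sandwich_join_point: "pmult n (pmult n (pr n {i, j}) (pr n {i})) (pr n {i, j}) = pr n {i, j}"
  unfolding pmult_join_point unfolding pr_join[OF ij(3)]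
proof (rule pmult_eq_fibres)
  fix x assume "x \<in> vertices n"
  then show "(x, join_lbl i j x) \<in> (product_graph (fibres n join_cut) (fibres n (join_lbl i j)))\<^sup>*"
    using ij by (intro product_graph_step[of x "case x of Bot k \<Rightarrow> Top (if k = i then j else k) | Top k \<Rightarrow> Bot (if k = i then j else k) | _ \<Rightarrow> x"])
      (auto simp: in_vertices join_cut_def block_graph_fibres split: if_splits)
qed (auto simp: in_vertices join_cut_def block_graph_fibres split: if_splits)

end

lemma pr_idem:
  assumes "A \<subseteq> {1..n}" "card A \<le> 2"
  shows "pmult n (pr n A) (pr n A) = pr n A"
proof -
  have "finite A" using assms(1) by (rule finite_subset) simp
  with assms(2) show ?thesis
  proof (cases rule: small_set_cases)
    case 1
    then show ?thesis by (simp add: pmult_id_left)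
  next
    case 2
    then show ?thesis by (simp add: idem_point)
  next
    case (3 i j)
    then show ?thesis using idem_join[of i n j] assms by auto
  qed
qed

lemma pr_projection: "A \<subseteq> {1..n} \<Longrightarrow> card A \<le> 2 \<Longrightarrow> pr n A \<in> projections n"
  by (simp add: projections_def pr_idem star_pr)

lemma pr_sandwich:
  assumes A: "A \<subseteq> {1..n}" "card A = 1 \<or> card A = 2" and B: "B \<subseteq> {1..n}" "card B = 1 \<or> card B = 2"
    and AB: "A \<subseteq> B \<or> B \<subseteq> A"
  shows "pmult n (pmult n (pr n A) (pr n B)) (pr n A) = pr n A"
proof -
  have fin: "finite A" "finite B" by (rule finite_subset, rule A B, simp)+
  consider "A = B" | "A \<subset> B" | "B \<subset> A" using AB by blast
  then show ?thesis
  proof cases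
    case 1
    then show ?thesis using pr_idem[of A n] A by auto
  next
    case 2
    then have "card A = 1" "card B = 2" using psubset_card_mono[OF fin(2) 2] A(2) B(2) by auto
    then obtain i j where "A = {i}" "B = {i, j}" "i \<noteq> j"
      using 2 by (auto simp: card_1_singleton_iff card_2_iff)
    then show ?thesis using sandwich_point_join[of i n j] B(1) by auto
  next
    case 3
    then have "card B = 1" "card A = 2" using psubset_card_mono[OF fin(1) 3] A(2) B(2) by auto
    then obtain i j where "B = {i}" "A = {i, j}" "i \<noteq> j"
      using 3 by (auto simp: card_1_singleton_iff card_2_iff)
    then show ?thesis using sandwich_join_point[of i n j] A(1) by auto
  qed
qed

text \<open>If the sets were incomparable, the product would inherit the defect of both: that of
  \<open>A\<close> from the leftmost factor, and that of \<open>B\<close> because its strings pass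
  unharmed through \<open>pr n A\<close>. A set with at most two elements can record only one
  defect, so \<open>C\<close> would equal both \<open>A\<close> and \<open>B\<close>.\<close>

lemma pr_sandwich_small:
  assumes A: "A \<subseteq> {1..n}" "card A \<le> 2" "A \<noteq> {}" and B: "B \<subseteq> {1..n}" "card B \<le> 2" "B \<noteq> {}"
    and C: "C \<subseteq> {1..n}" "card C \<le> 2"
    and eq: "pmult n (pmult n (pr n A) (pr n B)) (pr n A) = pr n C"
  shows "A \<subseteq> B \<or> B \<subseteq> A"
proof (rule ccontr)
  assume inc: "\<not> (A \<subseteq> B \<or> B \<subseteq> A)"
  have fin: "finite A" "finite B" "finite C" by (rule finite_subset, rule A B C, simp)+
  have isol: "C = {i}" if "i \<in> {1..n}" "\<And>y. (Top i, y) \<in> block_graph a \<Longrightarrow> y = Top i"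
    "pr n C = pmult n a b" "a \<in> partition_monoid n" for a b i
    using pmult_top_closed[OF that(4), of i "Bot i" b] that(2,3) pr_Top_Bot[OF C(2) fin(3) that(1)]
    by auto
  have pq: "pmult n (pr n A) (pr n B) \<in> partition_monoid n" by (rule pmult_partition_monoid)
  have "C = A"
    using A(2) fin(1)
  proof (cases rule: small_set_cases)
    case (2 i)
    have "(Top i, y) \<in> block_graph (pmult n (pr n A) (pr n B)) \<Longrightarrow> y = Top i" for y
      using pmult_top_closed[of "pr n A" n i y "pr n B"] A 2 fin(1) by (auto simp: block_graph_pr)
    then show ?thesis using isol[OF _ _ eq[symmetric] pq, of i] A(1) 2 by simp
  next
    case (3 i j)
    then have "(Top i, Top j) \<in> block_graph (pr n A)" using A fin by (simp add: pr_Top_Top)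
    then have "(Top i, Top j) \<in> block_graph (pr n C)"
      unfolding eq[symmetric] by (intro pmult_tops pq pr_partition_monoid)
    then show ?thesis using pr_Top_Top[OF C(2) fin(3), of i n j] A(1) 3 by simp
  qed (use A in simp)
  moreover have "C = B"
    using B(2) fin(2)
  proof (cases rule: small_set_cases)
    case (2 i)
    then have i: "i \<in> {1..n}" "i \<notin> A" using B(1) inc by auto
    have "y = Top i" if "(Top i, y) \<in> block_graph (pmult n (pr n A) (pr n B))" for y
    proof -
      \<comment> \<open>String \<open>i\<close> is intact in \<open>pr n A\<close> and
        \<open>pr n B\<close> isolates its continuation, so the component of \<open>Top i\<close>
        ends at \<open>Mid i\<close>.\<close>
      have "y \<in> {Top i, Mid i}"
      proof (rule rtrancl_closed)
        show "(Top i, y) \<in> (product_graph (pr n A) (pr n B))\<^sup>*"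
          using that by (simp add: block_graph_pmult)
        fix u v assume "u \<in> {Top i, Mid i}" "(u, v) \<in> product_graph (pr n A) (pr n B)"
        from this(2,1) show "v \<in> {Top i, Mid i}"
          by (cases rule: product_graph_cases)
            (use 2 i in \<open>auto simp: block_graph_pr[OF A(2) fin(1)] block_graph_pr[of "{i}"] in_vertices\<close>)
      qed simp
      then show ?thesis using that by (auto simp: block_graph_pmult)
    qed
    then show ?thesis using isol[OF i(1) _ eq[symmetric] pq] 2 by simp
  next
    case (3 i j)
    then have ij: "i \<in> {1..n}" "j \<in> {1..n}" "A \<noteq> {i}" "A \<noteq> {j}" using B(1) inc by auto
    have "(Top i, Bot i) \<in> block_graph (pr n A)" "(Bot j, Top j) \<in> block_graph (pr n A)"
      "(Top i, Top j) \<in> block_graph (pr n B)"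
      using A B fin 3 ij by (simp_all add: block_graph_pr)
    then have "(Top i, Mid i) \<in> product_graph (pr n A) (pr n B)"
      "(Mid i, Mid j) \<in> product_graph (pr n A) (pr n B)"
      "(Mid j, Top j) \<in> product_graph (pr n A) (pr n B)"
      using product_graphI1[of "Top i" "Bot i" "pr n A"] product_graphI1[of "Bot j" "Top j" "pr n A"]
        product_graphI2[of "Top i" "Top j" "pr n B"] by auto
    then have "(Top i, Top j) \<in> (product_graph (pr n A) (pr n B))\<^sup>*"
      by (meson converse_rtrancl_into_rtrancl rtrancl.rtrancl_refl)
    then have "(Top i, Top j) \<in> block_graph (pmult n (pr n A) (pr n B))"
      using ij by (simp add: block_graph_pmult)
    then have "(Top i, Top j) \<in> block_graph (pr n C)"
      unfolding eq[symmetric] by (rule pmult_tops[OF pq])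
    then show ?thesis using pr_Top_Top[OF C(2) fin(3), of i n j] ij 3 by simp
  qed (use B in simp)
  ultimately show False using inc by simp
qed


section \<open>Rank\<close>

text \<open>Rank at least n - 1 without counting blocks: apart from one index, which may lie outside
  \<open>{1..n}\<close>, the \<open>c\<close>-vertices reach the \<open>d\<close>-row and lie in
  different blocks. The parameters \<open>c\<close> and \<open>d\<close> allow both rows to play
  either role.\<close>

definition nearly_full :: "nat \<Rightarrow> (nat \<Rightarrow> vertex) \<Rightarrow> (nat \<Rightarrow> vertex) \<Rightarrow> diagram \<Rightarrow> bool" where
  "nearly_full n c d a \<longleftrightarrow> (\<exists>i. (\<forall>j\<in>{1..n} - {i}. \<exists>k\<in>{1..n}. (c j, d k) \<in> block_graph a) \<and>
    (\<forall>j\<in>{1..n} - {i}. \<forall>k\<in>{1..n} - {i}. (c j, c k) \<in> block_graph a \<longrightarrow> j = k))"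

definition transversals :: "nat \<Rightarrow> (nat \<Rightarrow> vertex) \<Rightarrow> (nat \<Rightarrow> vertex) \<Rightarrow> diagram \<Rightarrow> diagram" where
  "transversals n c d a = {B \<in> a. B \<inter> c ` {1..n} \<noteq> {} \<and> B \<inter> d ` {1..n} \<noteq> {}}"

lemma rank_transversals:
  "rank n a = card (transversals n Top Bot a)" "rank n a = card (transversals n Bot Top a)"
  by (auto simp: rank_def transversals_def top_vertices_def bot_vertices_def intro: arg_cong[of _ _ card])

lemma finite_transversals: "a \<in> partition_monoid n \<Longrightarrow> finite (transversals n c d a)"
  using finite_elements[OF finite_vertices, of n a] by (simp add: partition_monoid_def transversals_def)

lemma card_le_transversals:
  assumes a: "a \<in> partition_monoid n" and J: "J \<subseteq> {1..n}" and c: "\<forall>j\<in>J. c j \<in> vertices n"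
    and t: "\<forall>j\<in>J. \<exists>k\<in>{1..n}. (c j, d k) \<in> block_graph a"
    and inj: "\<forall>j\<in>J. \<forall>k\<in>J. (c j, c k) \<in> block_graph a \<longrightarrow> j = k"
  shows "card J \<le> card (transversals n c d a)"
proof (rule card_inj_on_le[OF _ _ finite_transversals[OF a]])
  let ?b = "\<lambda>j. block_graph a `` {c j}"
  show "?b ` J \<subseteq> transversals n c d a"
  proof
    fix B assume "B \<in> ?b ` J"
    then obtain j where j: "j \<in> J" "B = ?b j" by blast
    have "B \<in> vertices n // block_graph a" using c j by (auto intro: quotientI)
    then have "B \<in> a" using quotient_block_graph[OF a] by simp
    moreover have "c j \<in> B" using block_graph_refl[OF a] c j by auto
    moreover obtain k where "k \<in> {1..n}" "d k \<in> B" using t j by blast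
    ultimately show "B \<in> transversals n c d a" using j J by (auto simp: transversals_def)
  qed
  show "inj_on ?b J"
  proof (rule inj_onI)
    fix j k assume jk: "j \<in> J" "k \<in> J" "?b j = ?b k"
    then have "(c j, c k) \<in> block_graph a" using block_graph_refl[OF a, of "c k"] c by blast
    then show "j = k" using inj jk by blast
  qed
qed

text \<open>Blocks and indices determine each other: the indices other than \<open>i\<close> lie in
  distinct transversals, and conversely one representative per transversal uses all indices but at
  most one.\<close>

lemma nearly_full_iff:
  assumes a: "a \<in> partition_monoid n" and c: "\<forall>j\<in>{1..n}. c j \<in> vertices n"
  shows "nearly_full n c d a \<longleftrightarrow> n - 1 \<le> card (transversals n c d a)"
proof
  assume "nearly_full n c d a"
  then obtain i where t: "\<forall>j\<in>{1..n} - {i}. \<exists>k\<in>{1..n}. (c j, d k) \<in> block_graph a"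
    and inj: "\<forall>j\<in>{1..n} - {i}. \<forall>k\<in>{1..n} - {i}. (c j, c k) \<in> block_graph a \<longrightarrow> j = k"
    unfolding nearly_full_def by blast
  have "card ({1..n} - {i}) \<le> card (transversals n c d a)"
    using card_le_transversals[OF a _ _ t inj] c by blast
  moreover have "n - 1 \<le> card ({1..n} - {i})" by (simp add: card_Diff_singleton_if)
  ultimately show "n - 1 \<le> card (transversals n c d a)" by linarith
next
  assume le: "n - 1 \<le> card (transversals n c d a)"
  have "\<forall>B\<in>transversals n c d a. \<exists>j. j \<in> {1..n} \<and> c j \<in> B" by (auto simp: transversals_def)
  then obtain s where s: "\<forall>B\<in>transversals n c d a. s B \<in> {1..n} \<and> c (s B) \<in> B" by metis
  have block: "B = B'" if B: "B \<in> a" "B' \<in> a" "x \<in> B" "y \<in> B'" and xy: "(x, y) \<in> block_graph a" for B B' x y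
  proof -
    have *: "disjoint a" using a by (simp add: partition_monoid_def partition_on_def)
    obtain D where "D \<in> a" "x \<in> D" "y \<in> D" using xy by (auto simp: block_graph_def)
    then show ?thesis using disjointD[OF *, of B D] disjointD[OF *, of B' D] B by blast
  qed
  have Ta: "B \<in> a" if "B \<in> transversals n c d a" for B
    using that by (simp add: transversals_def)
  have inj: "inj_on s (transversals n c d a)"
  proof (rule inj_onI)
    fix B B' assume *: "B \<in> transversals n c d a" "B' \<in> transversals n c d a" "s B = s B'"
    have "(c (s B), c (s B)) \<in> block_graph a" using s c *(1) block_graph_refl[OF a] by blast
    then have "(c (s B), c (s B')) \<in> block_graph a" using *(3) by simp
    then show "B = B'" using block[OF Ta Ta] *(1,2) s by blast
  qed
  let ?I = "s ` transversals n c d a"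
  have I: "?I \<subseteq> {1..n}" using s by auto
  have "card ({1..n} - ?I) = n - card (transversals n c d a)"
    using card_image[OF inj] card_Diff_subset[OF finite_subset[OF I] I] by simp
  then have "card ({1..n} - ?I) \<le> 1" using le by linarith
  \<comment> \<open>The index missed by the representatives becomes the exceptional one; if none is
    missed, any \<open>i\<close> will do.\<close>
  then obtain i where i: "{1..n} - ?I \<subseteq> {i}"
    using card_le_Suc0_iff_eq[of "{1..n} - ?I"] by (metis One_nat_def finite_Diff finite_atLeastAtMost insertI1 subsetI singleton_iff)
  have B: "\<exists>B\<in>transversals n c d a. j = s B" if "j \<in> {1..n} - {i}" for j
    using i that by blast
  show "nearly_full n c d a"
    unfolding nearly_full_def
  proof (intro exI[of _ i] conjI ballI impI)
    fix j assume "j \<in> {1..n} - {i}"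
    then obtain B where "B \<in> transversals n c d a" "j = s B" using B by blast
    then show "\<exists>k\<in>{1..n}. (c j, d k) \<in> block_graph a"
      using s by (fastforce simp: transversals_def block_graph_def)
  next
    fix j k assume "j \<in> {1..n} - {i}" "k \<in> {1..n} - {i}" and jk: "(c j, c k) \<in> block_graph a"
    then obtain B B' where *: "B \<in> transversals n c d a" "j = s B" "B' \<in> transversals n c d a" "k = s B'"
      using B by metis
    then have "B = B'" using block[OF Ta Ta] jk s by blast
    then show "j = k" using * by simp
  qed
qed

lemma nearly_full_rank:
  assumes "a \<in> partition_monoid n"
  shows "nearly_full n Top Bot a \<longleftrightarrow> n - 1 \<le> rank n a" "nearly_full n Bot Top a \<longleftrightarrow> n - 1 \<le> rank n a"
  using nearly_full_iff[OF assms, of Top Bot] nearly_full_iff[OF assms, of Bot Top] rank_transversals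
  by simp_all

text \<open>Top vertices joined in \<open>a\<close> stay joined in the product, and one that reaches
  the bottom row in the product must do so in \<open>a\<close>. Hence \<open>nearly_full\<close>
  passes to \<open>a\<close> with the same exceptional index.\<close>

lemma rank_pmult_left:
  assumes a: "a \<in> partition_monoid n" and "n - 1 \<le> rank n (pmult n a b)"
  shows "n - 1 \<le> rank n a"
proof -
  have t: "\<exists>k\<in>{1..n}. (Top j, Bot k) \<in> block_graph a" if "(Top j, Bot k) \<in> block_graph (pmult n a b)" for j k
    using pmult_top_closed[OF a _ that] block_graph_vertices[OF a, of "Top j"] by fastforce
  have "nearly_full n Top Bot a"
    using assms(2)[folded nearly_full_rank(1)[OF pmult_partition_monoid]] t pmult_tops[OF a, of _ _ b]
    unfolding nearly_full_def by meson
  then show ?thesis using nearly_full_rank[OF a] by simp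
qed

lemma rank_pmult_right:
  assumes b: "b \<in> partition_monoid n" and "n - 1 \<le> rank n (pmult n a b)"
  shows "n - 1 \<le> rank n b"
proof -
  have t: "\<exists>k\<in>{1..n}. (Bot j, Top k) \<in> block_graph b" if "(Bot j, Top k) \<in> block_graph (pmult n a b)" for j k
    using pmult_bot_closed[OF b _ that] block_graph_vertices[OF b, of "Bot j"] by fastforce
  have "nearly_full n Bot Top b"
    using assms(2)[folded nearly_full_rank(2)[OF pmult_partition_monoid]] t pmult_bots[OF b, of _ _ a]
    unfolding nearly_full_def by meson
  then show ?thesis using nearly_full_rank[OF b] by simp
qed

lemma rank_pr: "A \<subseteq> {1..n} \<Longrightarrow> card A \<le> 2 \<Longrightarrow> n - 1 \<le> rank n (pr n A)"
proof -
  assume A: "A \<subseteq> {1..n}" "card A \<le> 2"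
  then have fin: "finite A" by (auto dest: finite_subset[OF _ finite_atLeastAtMost])
  obtain i where i: "\<forall>j. j \<noteq> i \<longrightarrow> A \<noteq> {j}" "\<forall>j k. j \<noteq> i \<longrightarrow> k \<noteq> i \<longrightarrow> j \<noteq> k \<longrightarrow> A \<noteq> {j, k}"
    using A(2) fin
  proof (cases rule: small_set_cases)
    case (2 i)
    then show ?thesis using that[of i] by auto
  next
    case (3 i j)
    then show ?thesis using that[of i] by auto
  qed (use that[of 0] in simp)
  have "nearly_full n Top Bot (pr n A)"
    unfolding nearly_full_def
    by (intro exI[of _ i]) (use i in \<open>auto simp: block_graph_pr[OF A(2) fin]\<close>)
  then show ?thesis by (simp add: nearly_full_rank)
qed

lemma rank_id: "n \<le> rank n (pr n {})"
proof -
  have "card {1..n} \<le> card (transversals n Top Bot (pr n {}))"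
    by (rule card_le_transversals) (auto simp: block_graph_pr)
  then show ?thesis by (simp add: rank_transversals)
qed

text \<open>Symmetry and idempotence straighten the transversals, so every string but one is intact.
  The classification then depends only on what happens at the exceptional index.\<close>

lemma projection_cases:
  assumes p: "p \<in> projections n" and rank: "n - 1 \<le> rank n p"
  obtains A where "A \<subseteq> {1..n}" "card A \<le> 2" "p = pr n A"
proof -
  have pm: "p \<in> partition_monoid n" and idem: "pmult n p p = p" and star: "star p = p"
    using p by (auto simp: projections_def)
  note sym = block_graph_sym[of _ _ p] and trans = block_graph_trans[OF pm]
    and refl = block_graph_refl[OF pm] and vert = block_graph_vertices[OF pm]
  have flip: "(flip x, flip y) \<in> block_graph p" if "(x, y) \<in> block_graph p" for x y
    using that block_graph_star[of "flip x" "flip y" p] star by simp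
  \<comment> \<open>By symmetry \<open>Bot x\<close> is joined to \<open>Top y\<close>; the two
    connections meet at \<open>Mid y\<close> in the product of \<open>p\<close> with itself.\<close>
  have TB: "(Top x, Bot x) \<in> block_graph p" if "(Top x, Bot y) \<in> block_graph p" for x y
  proof -
    have "(Top x, Mid y) \<in> product_graph p p" using product_graphI1[OF that, of p] by simp
    moreover have "(Mid y, Bot x) \<in> product_graph p p"
      using product_graphI2[OF sym[OF flip[OF that]], of p] by simp
    ultimately have "(Top x, Bot x) \<in> (product_graph p p)\<^sup>*" by auto
    moreover have "x \<in> {1..n}" using vert[OF that] by simp
    ultimately have "(Top x, Bot x) \<in> block_graph (pmult n p p)" by (simp add: block_graph_pmult)
    then show ?thesis using idem by simp
  qed
  obtain i where tr: "\<forall>j\<in>{1..n} - {i}. \<exists>k\<in>{1..n}. (Top j, Bot k) \<in> block_graph p"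
    and inj: "\<forall>j\<in>{1..n} - {i}. \<forall>k\<in>{1..n} - {i}. (Top j, Top k) \<in> block_graph p \<longrightarrow> j = k"
    using rank nearly_full_rank(1)[OF pm] unfolding nearly_full_def by blast
  have TBj: "(Top j, Bot j) \<in> block_graph p" if "j \<in> {1..n}" "j \<noteq> i" for j
    using tr TB that by blast
  \<comment> \<open>With every string intact, each vertex shares a block with the top vertex of its
    index, so the top row determines the diagram.\<close>
  have all: "block_graph p = block_graph (pr n A)"
    if A: "card A \<le> 2" "finite A" "A \<notin> range (\<lambda>i. {i})" and TBi: "\<forall>j\<in>{1..n}. (Top j, Bot j) \<in> block_graph p"
      and TT: "\<forall>j\<in>{1..n}. \<forall>k\<in>{1..n}. (Top j, Top k) \<in> block_graph p \<longleftrightarrow> j = k \<or> A = {j, k}" for A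
  proof -
    have up: "(x, Top (idx x)) \<in> block_graph p" if "x \<in> vertices n" for x
      using that TBi sym refl by (auto simp: in_vertices)
    have "(x, y) \<in> block_graph p \<longleftrightarrow> (Top (idx x), Top (idx y)) \<in> block_graph p"
      if "x \<in> vertices n" "y \<in> vertices n" for x y
      using up[OF that(1)] up[OF that(2)] sym trans by meson
    moreover have "idx x \<in> {1..n}" if "x \<in> vertices n" for x using that by (auto simp: in_vertices)
    moreover have "A \<noteq> {k}" for k using A(3) by blast
    ultimately have "(x, y) \<in> block_graph p \<longleftrightarrow> (x, y) \<in> block_graph (pr n A)" for x y
      unfolding block_graph_pr[OF A(1,2)] using TT vert by (metis insert_absorb2)
    then show ?thesis by auto
  qed
  \<comment> \<open>At the exceptional index \<open>i\<close> there is a join with another string,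
    an unchanged string (or no string, if \<open>i\<close> is outside \<open>{1..n}\<close>), or a
    cut.\<close>
  consider j where "j \<in> {1..n}" "j \<noteq> i" "i \<in> {1..n}" "(Top i, Top j) \<in> block_graph p"
    | "i \<notin> {1..n} \<or> (Top i, Bot i) \<in> block_graph p" "\<forall>j\<in>{1..n} - {i}. (Top i, Top j) \<notin> block_graph p"
    | "i \<in> {1..n}" "(Top i, Bot i) \<notin> block_graph p" "\<forall>j\<in>{1..n} - {i}. (Top i, Top j) \<notin> block_graph p"
  proof (cases "\<exists>j\<in>{1..n} - {i}. (Top i, Top j) \<in> block_graph p")
    case True
    then obtain j where j: "j \<in> {1..n}" "j \<noteq> i" "(Top i, Top j) \<in> block_graph p" by blast
    then show thesis using that(1)[of j] vert[OF j(3)] by simp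
  next
    case False
    then show thesis
      by (cases "i \<in> {1..n}"; cases "(Top i, Bot i) \<in> block_graph p") (use that(2,3) in auto)
  qed
  then show thesis
  proof cases
    case (1 j)
    have "(Bot j, Bot i) \<in> block_graph p" using sym[OF flip[OF 1(4)]] by simp
    then have "(Top i, Bot i) \<in> block_graph p"
      using trans[OF 1(4) trans[OF TBj[OF 1(1,2)]]] by blast
    moreover have "(Top k, Top l) \<in> block_graph p \<longleftrightarrow> k = l \<or> {i, j} = {k, l}"
      if kl: "k \<in> {1..n}" "l \<in> {1..n}" for k l
    proof -
      have "(Top i, Top l) \<in> block_graph p \<longleftrightarrow> l = i \<or> l = j" if "l \<in> {1..n}" for l
      proof (cases "l = i")
        case False
        have "(Top i, Top l) \<in> block_graph p \<longleftrightarrow> (Top j, Top l) \<in> block_graph p"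
          using 1(4) sym trans by blast
        also have "\<dots> \<longleftrightarrow> j = l" using inj[rule_format, of j l] refl[of "Top j"] that False 1(1,2) by auto
        finally show ?thesis using False by auto
      qed (use refl that in auto)
      note * = this
      show ?thesis
      proof (cases "k = i \<or> l = i")
        case True
        moreover have "(Top k, Top l) \<in> block_graph p \<longleftrightarrow> (Top l, Top k) \<in> block_graph p"
          using sym by blast
        ultimately show ?thesis using *[OF kl(1)] *[OF kl(2)] 1(2) by (auto simp: doubleton_eq_iff)
      next
        case False
        then show ?thesis using inj[rule_format, of k l] refl[of "Top k"] kl by (auto simp: doubleton_eq_iff)
      qed
    qed
    moreover have "(Top k, Bot k) \<in> block_graph p" if "k \<in> {1..n}" for k
      using calculation(1) TBj[OF that] by (cases "k = i") auto
    ultimately have "block_graph p = block_graph (pr n {i, j})"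
      using 1(2) by (intro all) (auto simp: doubleton_eq_iff)
    then show thesis
      using that[of "{i, j}"] 1 diagram_eqI[OF pm pr_partition_monoid] by auto
  next
    case 2
    have "block_graph p = block_graph (pr n {})"
    proof (rule all)
      show "\<forall>j\<in>{1..n}. (Top j, Bot j) \<in> block_graph p" using 2 TBj by metis
      show "\<forall>j\<in>{1..n}. \<forall>k\<in>{1..n}. (Top j, Top k) \<in> block_graph p \<longleftrightarrow> j = k \<or> {} = {j, k}"
      proof (intro ballI)
        fix j k assume jk: "j \<in> {1..n}" "k \<in> {1..n}"
        have "j = k" if "(Top j, Top k) \<in> block_graph p"
          using that sym[OF that] inj[rule_format, of j k] 2(2)[rule_format, of j] 2(2)[rule_format, of k] jk
          by (cases "j = i"; cases "k = i") auto
        then show "(Top j, Top k) \<in> block_graph p \<longleftrightarrow> j = k \<or> {} = {j, k}" using refl[of "Top j"] jk by auto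
      qed
    qed auto
    then show thesis
      using that[of "{}"] diagram_eqI[OF pm pr_partition_monoid] by auto
  next
    case 3
    have T: "y = Top i" if y: "(Top i, y) \<in> block_graph p" for y
    proof -
      obtain k where k: "k \<in> {1..n}" "y = Top k \<or> y = Bot k" using vert[OF y] by (auto simp: in_vertices)
      have "k = i"
      proof (rule ccontr)
        assume "k \<noteq> i"
        then have "(y, Top k) \<in> block_graph p" using k sym[OF TBj[OF k(1)]] refl[of "Top k"] by auto
        then have "(Top i, Top k) \<in> block_graph p" by (rule trans[OF y])
        then show False using 3 k \<open>k \<noteq> i\<close> by blast
      qed
      then show ?thesis using k 3(2) y by auto
    qed
    have B: "y = Bot i" if "(Bot i, y) \<in> block_graph p" for y
      using T[of "flip y"] flip[OF that] by (cases y) auto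
    have up: "(x, Top (idx x)) \<in> block_graph p" if "x \<in> vertices n" "idx x \<noteq> i" for x
      using that TBj sym refl by (auto simp: in_vertices)
    have "(x, y) \<in> block_graph p \<longleftrightarrow> (x, y) \<in> block_graph (pr n {i})" for x y
    proof (cases "x \<in> vertices n \<and> y \<in> vertices n")
      case True
      then have xy: "idx x \<in> {1..n}" "idx y \<in> {1..n}" by (auto simp: in_vertices)
      show ?thesis
      proof (cases "idx x = i \<or> idx y = i")
        case T': True
        have "(x, y) \<in> block_graph p \<longleftrightarrow> x = y"
        proof
          assume xy: "(x, y) \<in> block_graph p"
          show "x = y"
            using T' True xy sym[OF xy] by (auto simp: in_vertices dest: T B)
        qed (use refl True in auto)
        then show ?thesis using T' True by (auto simp: block_graph_pr)
      next
        case False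
        have "(x, y) \<in> block_graph p \<longleftrightarrow> (Top (idx x), Top (idx y)) \<in> block_graph p"
          using up[of x] up[of y] True False sym trans by meson
        also have "\<dots> \<longleftrightarrow> idx x = idx y" using inj[rule_format, of "idx x" "idx y"] refl[of "Top (idx x)"] False xy by auto
        finally show ?thesis using False True by (auto simp: block_graph_pr)
      qed
    qed (use vert in \<open>auto simp: block_graph_pr\<close>)
    then have "block_graph p = block_graph (pr n {i})" by auto
    then show thesis
      using that[of "{i}"] 3 diagram_eqI[OF pm pr_partition_monoid] by auto
  qed
qed


section \<open>The subdivided complete graph\<close>

text \<open>The vertices are the points \<^term>\<open>{i}\<close> and the edge midpoints \<^term>\<open>{i, j}\<close> of the complete graph on
  \<^term>\<open>{1..n}\<close>, both coded as sets; incidence is inclusion.\<close>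

definition codes :: "nat \<Rightarrow> nat set set" where
  "codes n = {A. A \<subseteq> {1..n} \<and> (card A = 1 \<or> card A = 2)}"

definition adj :: "nat \<Rightarrow> diagram \<Rightarrow> diagram \<Rightarrow> bool" where
  "adj n p q \<longleftrightarrow> (\<exists>A\<in>codes n. \<exists>B\<in>codes n. p = pr n A \<and> q = pr n B \<and> (A \<subseteq> B \<or> B \<subseteq> A))"

text \<open>The spanning tree is the subdivided star at the point 1 with each other midpoint \<^term>\<open>{i, j}\<close>
  attached to its smaller endpoint, so every 2-subset \<^term>\<open>\<gamma> x\<close> of \<^term>\<open>{2..n}\<close> leaves exactly one
  edge outside the tree, from \<^term>\<open>\<gamma> x\<close> to \<^term>\<open>{Max (\<gamma> x)}\<close>.\<close>

definition co_tree_end :: "nat \<Rightarrow> ('x \<Rightarrow> nat set) \<Rightarrow> 'x \<Rightarrow> bool \<Rightarrow> diagram" where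
  "co_tree_end n \<gamma> x b = pr n (if b then \<gamma> x else {Max (\<gamma> x)})"

text \<open>Tree edges and repetitions get the empty label. The choice is harmless, since
  \<open>co_tree_unique\<close> leaves a single candidate.\<close>

definition edge_label :: "nat \<Rightarrow> ('x \<Rightarrow> nat set) \<Rightarrow> 'x set \<Rightarrow> diagram \<Rightarrow> diagram \<Rightarrow> ('x \<times> bool) list" where
  "edge_label n \<gamma> X p q =
    (if \<exists>x\<in>X. \<exists>b. p = co_tree_end n \<gamma> x b \<and> q = co_tree_end n \<gamma> x (\<not> b)
     then [SOME a. fst a \<in> X \<and> p = co_tree_end n \<gamma> (fst a) (snd a) \<and> q = co_tree_end n \<gamma> (fst a) (\<not> snd a)]
     else [])"

definition point_walk :: "nat \<Rightarrow> nat set list" where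
  "point_walk j = (if j = 1 then [{1}] else [{1}, {1, j}, {j}])"

definition code_walk :: "nat set \<Rightarrow> nat set list" where
  "code_walk A = (if card A = 1 then point_walk (Min A) else point_walk (Min A) @ [A])"

definition code :: "nat \<Rightarrow> diagram \<Rightarrow> nat set" where
  "code n = the_inv_into {A. A \<subseteq> {1..n} \<and> card A \<le> 2} (pr n)"

definition tree_walk :: "nat \<Rightarrow> diagram \<Rightarrow> diagram list" where
  "tree_walk n p = map (pr n) (code_walk (code n p))"

lemma code_pr: "A \<subseteq> {1..n} \<Longrightarrow> card A \<le> 2 \<Longrightarrow> code n (pr n A) = A"
proof -
  assume A: "A \<subseteq> {1..n}" "card A \<le> 2"
  have "inj_on (pr n) {A. A \<subseteq> {1..n} \<and> card A \<le> 2}"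
    by (rule inj_onI, rule pr_inj) auto
  then show ?thesis
    unfolding code_def by (rule the_inv_into_f_f) (use A in simp)
qed

lemma codesD: "A \<in> codes n \<Longrightarrow> A \<subseteq> {1..n} \<and> card A \<le> 2 \<and> A \<noteq> {}"
  by (auto simp: codes_def)

lemma codes_inj: "A \<in> codes n \<Longrightarrow> B \<in> codes n \<Longrightarrow> pr n A = pr n B \<longleftrightarrow> A = B"
  using pr_inj codesD by blast

lemma point_code: "j \<in> {1..n} \<Longrightarrow> {j} \<in> codes n"
  and pair_code: "i \<in> {1..n} \<Longrightarrow> j \<in> {1..n} \<Longrightarrow> i < j \<Longrightarrow> {i, j} \<in> codes n"
  by (auto simp: codes_def)

lemma codes_cases:
  assumes "A \<in> codes n"
  obtains j where "j \<in> {1..n}" "A = {j}" | i j where "i \<in> {1..n}" "j \<in> {1..n}" "i < j" "A = {i, j}"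
proof -
  have "finite A" using assms by (auto simp: codes_def intro: card_ge_0_finite)
  with codesD[OF assms] show ?thesis
    using small_set_cases[of A] that by (metis insert_subset)
qed

lemma tree_walk_point: "j \<in> {1..n} \<Longrightarrow> tree_walk n (pr n {j}) = map (pr n) (point_walk j)"
  by (simp add: tree_walk_def code_pr code_walk_def)

lemma tree_walk_pair:
  "i \<in> {1..n} \<Longrightarrow> j \<in> {1..n} \<Longrightarrow> i < j \<Longrightarrow>
    tree_walk n (pr n {i, j}) = map (pr n) (point_walk i) @ [pr n {i, j}]"
  by (simp add: tree_walk_def code_pr code_walk_def)

lemma adj_cases:
  assumes "adj n p q"
  obtains A where "A \<in> codes n" "p = pr n A" "q = p"
    | i j k where "i \<in> {1..n}" "j \<in> {1..n}" "i < j" "k = i \<or> k = j" "p = pr n {k}" "q = pr n {i, j}"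
    | i j k where "i \<in> {1..n}" "j \<in> {1..n}" "i < j" "k = i \<or> k = j" "p = pr n {i, j}" "q = pr n {k}"
proof -
  obtain A B where AB: "A \<in> codes n" "B \<in> codes n" "p = pr n A" "q = pr n B" "A \<subseteq> B \<or> B \<subseteq> A"
    using assms by (auto simp: adj_def)
  show ?thesis
  proof (cases "A = B")
    case True
    then show ?thesis using that(1)[of A] AB by simp
  next
    case ne: False
    show ?thesis
      using AB(1)
    proof (cases rule: codes_cases)
      case A: (1 k)
      show ?thesis
        using AB(2)
      proof (cases rule: codes_cases)
        case (1 l)
        then show ?thesis using A ne AB(5) by auto
      next
        case (2 i j)
        then show ?thesis using A that(2)[of i j k] AB by auto
      qed
    next
      case A: (2 i j)
      show ?thesis
        using AB(2)
      proof (cases rule: codes_cases)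
        case (1 k)
        then show ?thesis using A that(3)[of i j k] AB by auto
      next
        case (2 k l)
        then show ?thesis using A ne AB(5) by (auto simp: doubleton_eq_iff)
      qed
    qed
  qed
qed

text \<open>A product of large rank has factors of large rank, so the classification turns
  \<open>p\<close> and \<open>q\<close> into sets and \<open>pr_sandwich_small\<close> compares
  these. Contrapositively, a sandwich over a pair that is not an edge leaves the graph.\<close>

lemma sandwich_small_rank:
  assumes p: "p \<in> projections n" "p \<noteq> pr n {}" and q: "q \<in> projections n" "q \<noteq> pr n {}"
    and C: "C \<subseteq> {1..n}" "card C \<le> 2" "pmult n (pmult n p q) p = pr n C"
  shows "adj n p q"
proof -
  have "n - 1 \<le> rank n (pmult n (pmult n p q) p)" using rank_pr C by simp
  then have pq: "n - 1 \<le> rank n (pmult n p q)" by (rule rank_pmult_left[OF pmult_partition_monoid])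
  have pm: "p \<in> partition_monoid n" "q \<in> partition_monoid n" using p q by (auto simp: projections_def)
  obtain A where A: "A \<subseteq> {1..n}" "card A \<le> 2" "p = pr n A"
    using projection_cases[OF p(1) rank_pmult_left[OF pm(1) pq]] .
  obtain B where B: "B \<subseteq> {1..n}" "card B \<le> 2" "q = pr n B"
    using projection_cases[OF q(1) rank_pmult_right[OF pm(2) pq]] .
  have ne: "A \<noteq> {}" "B \<noteq> {}" using p q A B by auto
  have "A \<subseteq> B \<or> B \<subseteq> A"
    using pr_sandwich_small[OF A(1,2) ne(1) B(1,2) ne(2) C(1,2)] C(3) A(3) B(3) by simp
  moreover have codes: "D \<in> codes n" if "D \<subseteq> {1..n}" "card D \<le> 2" "D \<noteq> {}" for D
  proof -
    have "card D \<noteq> 0" using that finite_subset[OF that(1)] by simp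
    then have "card D = 1 \<or> card D = 2" using that(2) by linarith
    then show ?thesis using that(1) by (simp add: codes_def)
  qed
  ultimately show ?thesis
    unfolding adj_def A(3) B(3) using codes[OF A(1,2) ne(1)] codes[OF B(1,2) ne(2)] by blast
qed

section \<open>Labels and tree walks for a numbering of the 2-subsets of {2..n}\<close>

context
  fixes n :: nat and \<gamma> :: "'x \<Rightarrow> nat set" and X :: "'x set"
  assumes n: "1 \<le> n" and \<gamma>: "bij_betw \<gamma> X {A. A \<subseteq> {2..n} \<and> card A = 2}"
begin

lemma \<gamma>_props:
  assumes "x \<in> X"
  obtains i j where "\<gamma> x = {i, j}" "2 \<le> i" "i < j" "j \<le> n" "Max (\<gamma> x) = j"
proof -
  have x: "\<gamma> x \<subseteq> {2..n}" "card (\<gamma> x) = 2" using bij_betwE[OF \<gamma>] assms by auto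
  then have "finite (\<gamma> x)" by (auto intro: card_ge_0_finite)
  then obtain i j where "\<gamma> x = {i, j}" "i < j"
    using small_set_cases[of "\<gamma> x"] x(2) by (metis card.empty card_1_singleton_iff numeral_eq_one_iff order_refl semiring_norm(85) zero_neq_numeral One_nat_def)
  then show ?thesis using that[of i j] x(1) by (auto simp: max_def)
qed

lemma co_tree_codes: "x \<in> X \<Longrightarrow> (if b then \<gamma> x else {Max (\<gamma> x)}) \<in> codes n"
  by (rule \<gamma>_props[of x]) (auto simp: codes_def)

text \<open>The midpoint is a set of two elements and the endpoint a singleton, so the orientation
  is determined; the rest is injectivity of \<open>\<gamma>\<close>.\<close>

lemma co_tree_unique:
  assumes "x \<in> X" "y \<in> X" "co_tree_end n \<gamma> x b = co_tree_end n \<gamma> y c"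
    "co_tree_end n \<gamma> x (\<not> b) = co_tree_end n \<gamma> y (\<not> c)"
  shows "x = y \<and> b = c"
proof -
  have b: "(if b then \<gamma> x else {Max (\<gamma> x)}) = (if c then \<gamma> y else {Max (\<gamma> y)})"
    using assms(3) codes_inj co_tree_codes[OF assms(1), of b] co_tree_codes[OF assms(2), of c]
    unfolding co_tree_end_def by blast
  have nb: "(if \<not> b then \<gamma> x else {Max (\<gamma> x)}) = (if \<not> c then \<gamma> y else {Max (\<gamma> y)})"
    using assms(4) codes_inj co_tree_codes[OF assms(1), of "\<not> b"] co_tree_codes[OF assms(2), of "\<not> c"]
    unfolding co_tree_end_def by blast
  have card: "card (\<gamma> x) = 2" "card (\<gamma> y) = 2" using bij_betwE[OF \<gamma>] assms(1,2) by auto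
  have bc: "b = c"
  proof (rule ccontr)
    assume "b \<noteq> c"
    then have "\<gamma> x = {Max (\<gamma> y)} \<or> \<gamma> y = {Max (\<gamma> x)}" using b by (cases b) auto
    then have "card (\<gamma> x) = card {Max (\<gamma> y)} \<or> card (\<gamma> y) = card {Max (\<gamma> x)}" by metis
    then show False using card by simp
  qed
  then have "\<gamma> x = \<gamma> y" using b nb by (cases b) auto
  then show ?thesis using bc \<gamma> assms(1,2) by (auto dest: inj_onD[OF bij_betw_imp_inj_on])
qed

lemma co_tree_adj: "x \<in> X \<Longrightarrow> adj n (co_tree_end n \<gamma> x b) (co_tree_end n \<gamma> x (\<not> b))"
proof -
  assume x: "x \<in> X"
  have "Max (\<gamma> x) \<in> \<gamma> x" by (rule \<gamma>_props[OF x]) auto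
  then have "(if b then \<gamma> x else {Max (\<gamma> x)}) \<subseteq> (if \<not> b then \<gamma> x else {Max (\<gamma> x)}) \<or>
    (if \<not> b then \<gamma> x else {Max (\<gamma> x)}) \<subseteq> (if b then \<gamma> x else {Max (\<gamma> x)})" by auto
  then show ?thesis
    unfolding adj_def co_tree_end_def using co_tree_codes[OF x, of b] co_tree_codes[OF x, of "\<not> b"] by blast
qed

lemma edge_label_co_tree:
  assumes x: "x \<in> X"
  shows "edge_label n \<gamma> X (co_tree_end n \<gamma> x b) (co_tree_end n \<gamma> x (\<not> b)) = [(x, b)]"
proof -
  have "(SOME a. fst a \<in> X \<and> co_tree_end n \<gamma> x b = co_tree_end n \<gamma> (fst a) (snd a) \<and>
      co_tree_end n \<gamma> x (\<not> b) = co_tree_end n \<gamma> (fst a) (\<not> snd a)) = (x, b)"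
    using x co_tree_unique by (intro some_equality) (auto simp: prod_eq_iff)
  then show ?thesis unfolding edge_label_def using x by auto
qed

lemma edge_label_cases:
  "edge_label n \<gamma> X p q = [] \<or> (\<exists>x\<in>X. \<exists>b. p = co_tree_end n \<gamma> x b \<and> q = co_tree_end n \<gamma> x (\<not> b))"
  by (simp add: edge_label_def)

lemma co_tree_pair:
  assumes x: "x \<in> X" and A: "A \<in> codes n" and B: "B \<in> codes n"
    and p: "pr n A = co_tree_end n \<gamma> x b" and q: "pr n B = co_tree_end n \<gamma> x (\<not> b)"
  shows "\<exists>i j. 2 \<le> i \<and> i < j \<and> {A, B} = {{i, j}, {j}}"
proof -
  have "A = (if b then \<gamma> x else {Max (\<gamma> x)})" "B = (if \<not> b then \<gamma> x else {Max (\<gamma> x)})"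
    using p q codes_inj A B co_tree_codes[OF x] unfolding co_tree_end_def by blast+
  moreover obtain i j where "\<gamma> x = {i, j}" "2 \<le> i" "i < j" "Max (\<gamma> x) = j"
    using \<gamma>_props[OF x] by metis
  ultimately show ?thesis by (intro exI[of _ i] exI[of _ j]) (cases b; auto)
qed

lemma edge_label_Nil:
  assumes "A \<in> codes n" "B \<in> codes n" "\<And>i j. 2 \<le> i \<Longrightarrow> i < j \<Longrightarrow> {A, B} \<noteq> {{i, j}, {j}}"
  shows "edge_label n \<gamma> X (pr n A) (pr n B) = []"
  using edge_label_cases[of "pr n A" "pr n B"] co_tree_pair[OF _ assms(1,2)] assms(3) by meson

abbreviation tree :: "diagram \<Rightarrow> diagram \<Rightarrow> bool" where
  "tree p q \<equiv> adj n p q \<and> edge_label n \<gamma> X p q = []"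

lemma tree_lower:
  assumes ij: "i \<in> {1..n}" "j \<in> {1..n}" "i < j"
  shows "tree (pr n {i}) (pr n {i, j})"
proof
  show "adj n (pr n {i}) (pr n {i, j})"
    unfolding adj_def using point_code[OF ij(1)] pair_code[OF ij] by blast
  show "edge_label n \<gamma> X (pr n {i}) (pr n {i, j}) = []"
    by (rule edge_label_Nil[OF point_code[OF ij(1)] pair_code[OF ij]])
      (use ij in \<open>auto simp: doubleton_eq_iff\<close>)
qed

lemma tree_root:
  assumes j: "j \<in> {1..n}" "1 < j"
  shows "tree (pr n {1, j}) (pr n {j})"
proof
  have "{1, j} \<in> codes n" using pair_code[of 1 n j] n j by simp
  with point_code[OF j(1)] show "adj n (pr n {1, j}) (pr n {j})"
    unfolding adj_def by blast
  show "edge_label n \<gamma> X (pr n {1, j}) (pr n {j}) = []"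
    by (rule edge_label_Nil[OF \<open>{1, j} \<in> codes n\<close> point_code[OF j(1)]])
      (use j in \<open>auto simp: doubleton_eq_iff\<close>)
qed

text \<open>For \<open>i \<noteq> 1\<close> the pair lies in \<open>{2..n}\<close>, hence is some
  \<open>\<gamma> x\<close>, and its edge to the larger endpoint carries a letter in both
  directions.\<close>

lemma tree_upper_root:
  assumes ij: "i \<in> {1..n}" "j \<in> {1..n}" "i < j"
    and "edge_label n \<gamma> X (pr n {j}) (pr n {i, j}) = [] \<or> edge_label n \<gamma> X (pr n {i, j}) (pr n {j}) = []"
  shows "i = 1"
proof (rule ccontr)
  assume "i \<noteq> 1"
  then have "{i, j} \<in> \<gamma> ` X" using \<gamma> ij by (auto simp: bij_betw_def)
  then obtain x where x: "x \<in> X" "\<gamma> x = {i, j}" by auto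
  have "Max {i, j} = j" using ij by simp
  then have "co_tree_end n \<gamma> x True = pr n {i, j}" "co_tree_end n \<gamma> x False = pr n {j}"
    using x(2) by (simp_all add: co_tree_end_def)
  then show False
    using assms(4) edge_label_co_tree[OF x(1), of True] edge_label_co_tree[OF x(1), of False] by simp
qed

lemma tree_walk_props:
  assumes "A \<in> codes n"
  shows "tree_walk n (pr n A) \<noteq> []" "hd (tree_walk n (pr n A)) = pr n {1}"
    "last (tree_walk n (pr n A)) = pr n A" "successively tree (tree_walk n (pr n A))"
proof -
  have point: "hd (map (pr n) (point_walk j)) = pr n {1} \<and> last (map (pr n) (point_walk j)) = pr n {j} \<and>
      map (pr n) (point_walk j) \<noteq> [] \<and> successively tree (map (pr n) (point_walk j))"
    if j: "j \<in> {1..n}" for j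
  proof (cases "j = 1")
    case False
    then show ?thesis using tree_lower[of 1 j] tree_root[of j] j n by (simp add: point_walk_def)
  qed (simp add: point_walk_def)
  show "tree_walk n (pr n A) \<noteq> []" "hd (tree_walk n (pr n A)) = pr n {1}"
    "last (tree_walk n (pr n A)) = pr n A" "successively tree (tree_walk n (pr n A))"
    using assms by (cases rule: codes_cases;
      use point tree_lower in \<open>simp add: tree_walk_point tree_walk_pair successively_append_iff\<close>)+
qed

lemma PG_idem: "p \<in> projections n \<Longrightarrow> ([p, p], [p]) \<in> word_cong (projections n) (PG_rels (projections n) (pmult n))"
  by (rule word_cong_rel) (auto simp: PG_rels_def)

lemma PG_sandwich:
  assumes "p \<in> projections n" "q \<in> projections n" "pmult n (pmult n p q) p = p"
  shows "([p, q, p], [p]) \<in> word_cong (projections n) (PG_rels (projections n) (pmult n))"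
proof (rule word_cong_rel)
  have "([p, q, p], [pmult n (pmult n p q) p]) \<in> PG_rels (projections n) (pmult n)"
    unfolding PG_rels_def using assms(1,2) by blast
  then show "([p, q, p], [p]) \<in> PG_rels (projections n) (pmult n)" using assms(3) by simp
qed (use assms in auto)

lemma codes_projection: "A \<in> codes n \<Longrightarrow> pr n A \<in> projections n"
  using codesD pr_projection by blast

lemma adj_sandwich: "adj n p q \<Longrightarrow> pmult n (pmult n p q) p = p"
proof -
  assume "adj n p q"
  then obtain A B where "A \<in> codes n" "B \<in> codes n" "p = pr n A" "q = pr n B" "A \<subseteq> B \<or> B \<subseteq> A"
    unfolding adj_def by blast
  then show ?thesis using pr_sandwich[of A n B] unfolding codes_def by simp
qed

text \<open>A tree edge either prolongs the tree walk by one vertex or retraces its last step. In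
  the second case the word ends in \<open>q, p, q\<close>, which collapses to \<open>q\<close>; a
  repetition collapses by idempotence.\<close>

lemma tree_walk_step:
  assumes pq: "tree p q"
  shows "(tree_walk n p @ [q], tree_walk n q) \<in> word_cong (projections n) (PG_rels (projections n) (pmult n))"
    (is "_ \<in> ?C")
proof -
  have proj: "p \<in> projections n" "q \<in> projections n"
    using pq codes_projection by (auto simp: adj_def)
  have walk: "tree_walk n (pr n A) \<in> lists (projections n)" if "A \<in> codes n" for A
  proof -
    have *: "\<forall>A\<in>set (point_walk j). pr n A \<in> projections n" if "j \<in> {1..n}" for j
      using that n pr_projection[of "{1}" n] pr_projection[of "{j}" n] pr_projection[of "{1, j}" n]
      by (auto simp: point_walk_def)
    from that codes_projection[OF that] show ?thesis
    proof (cases rule: codes_cases)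
      case (1 j)
      then show ?thesis using *[of j] by (auto simp: tree_walk_point)
    next
      case (2 i j)
      then show ?thesis using *[of i] codes_projection[OF that] by (auto simp: tree_walk_pair)
    qed
  qed
  have absorb: "(w @ [q, p, q], w @ [q]) \<in> ?C" if "w \<in> lists (projections n)" for w
  proof (intro word_cong_append word_cong_refl that PG_sandwich proj)
    show "pmult n (pmult n q p) q = q" using pq adj_sandwich[of q p] by (auto simp: adj_def)
  qed
  have last: "tree_walk n (pr n A) = butlast (tree_walk n (pr n A)) @ [pr n A]" if "A \<in> codes n" for A
    using tree_walk_props(1,3)[OF that] by (metis append_butlast_last_id)
  have up: "(tree_walk n p @ [q], tree_walk n q) \<in> ?C"
    if "tree_walk n p = tree_walk n q @ [p]" "B \<in> codes n" "q = pr n B" for B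
  proof -
    have "butlast (tree_walk n q) \<in> lists (projections n)"
      using walk[OF that(2)] that(3) by (auto dest: in_set_butlastD)
    from absorb[OF this] show ?thesis
      unfolding that(1) using last[OF that(2)] that(3) by (metis append_Cons append_Nil append_assoc)
  qed
  have refl: "(tree_walk n p @ [q], tree_walk n q) \<in> ?C"
    if "tree_walk n q = tree_walk n p @ [q]" "B \<in> codes n" "q = pr n B" for B
    using walk[OF that(2)] that by (simp add: word_cong_refl)
  from pq have "adj n p q" by simp
  then show ?thesis
  proof (cases rule: adj_cases)
    case (1 A)
    have "butlast (tree_walk n p) \<in> lists (projections n)"
      using walk[OF 1(1)] 1(2) by (auto dest: in_set_butlastD)
    then have "(butlast (tree_walk n p) @ [p, p], butlast (tree_walk n p) @ [p]) \<in> ?C"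
      by (intro word_cong_append word_cong_refl PG_idem proj)
    then show ?thesis using last[OF 1(1)] 1(2,3) by (metis append_Cons append_Nil append_assoc)
  next
    case (2 i j k)
    have c: "{i, j} \<in> codes n" by (rule pair_code) fact+
    show ?thesis
    proof (cases "k = i")
      case True
      then show ?thesis using 2 refl[OF _ c 2(6)] by (simp add: tree_walk_point tree_walk_pair)
    next
      case False
      \<comment> \<open>A tree edge at the larger endpoint forces \<open>i = 1\<close>, so the walk
        to \<open>{j}\<close> passes through \<open>{1, j}\<close> just before its end.\<close>
      then have "k = j" "i = 1" using 2 tree_upper_root[of i j] pq by auto
      then show ?thesis using 2 up[OF _ c 2(6)]
        by (simp add: tree_walk_point tree_walk_pair point_walk_def)
    qed
  next
    case (3 i j k)
    have c: "{k} \<in> codes n" using 3 by (auto intro: point_code)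
    show ?thesis
    proof (cases "k = i")
      case True
      then show ?thesis using 3 up[OF _ c 3(6)] by (simp add: tree_walk_point tree_walk_pair)
    next
      case False
      then have "k = j" "i = 1" using 3 tree_upper_root[of i j] pq by auto
      then show ?thesis using 3 refl[OF _ c 3(6)]
        by (simp add: tree_walk_point tree_walk_pair point_walk_def)
    qed
  qed
qed

lemma pg_graph_codes:
  assumes "A0 \<in> codes n"
  shows "pg_graph (projections n) (pmult n) (pr n {}) (pr n A0) (pr n ` codes n) (adj n) X
    (edge_label n \<gamma> X) (co_tree_end n \<gamma>) (tree_walk n)"
proof
  show "pr n ` codes n \<subseteq> projections n" using codes_projection by blast
  show "pr n {} \<in> projections n" by (rule pr_projection) auto
  show "pr n {} \<notin> pr n ` codes n"
  proof
    assume "pr n {} \<in> pr n ` codes n"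
    then obtain A where "A \<in> codes n" "pr n {} = pr n A" by blast
    then show False using pr_inj[of "{}" n A] codesD[of A n] by simp
  qed
  show "pr n A0 \<in> pr n ` codes n" using assms by blast
  show "p \<in> pr n ` codes n \<and> q \<in> pr n ` codes n" if "adj n p q" for p q
    using that by (auto simp: adj_def)
  show "adj n p p" if "p \<in> pr n ` codes n" for p
    using that by (auto simp: adj_def)
  show "adj n q p" if "adj n p q" for p q
    using that by (auto simp: adj_def)
  show "pmult n (pmult n (pr n {}) q) (pr n {}) = q" if "q \<in> projections n" for q
    using that pmult_id_left pmult_id_right by (simp add: projections_def)
  show "pmult n (pmult n q (pr n {})) q = q" if "q \<in> projections n" for q
    using that pmult_id_right by (simp add: projections_def)
  show "pmult n (pmult n p q) p = p" if "adj n p q" for p q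
    by (rule adj_sandwich) fact
  show "pmult n (pmult n p q) p \<notin> insert (pr n {}) (pr n ` codes n)"
    if "p \<in> projections n" "q \<in> projections n" "p \<noteq> pr n {}" "q \<noteq> pr n {}" "\<not> adj n p q" for p q
  proof
    assume "pmult n (pmult n p q) p \<in> insert (pr n {}) (pr n ` codes n)"
    then obtain C where "C = {} \<or> C \<in> codes n" "pmult n (pmult n p q) p = pr n C" by blast
    then show False
      using sandwich_small_rank[OF that(1,3,2,4), of C] that(5) codesD[of C n] by auto
  qed
  show "adj n (co_tree_end n \<gamma> x b) (co_tree_end n \<gamma> x (\<not> b))" if "x \<in> X" for x b
    using that by (rule co_tree_adj)
  show "edge_label n \<gamma> X (co_tree_end n \<gamma> x b) (co_tree_end n \<gamma> x (\<not> b)) = [(x, b)]" if "x \<in> X" for x b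
    using that by (rule edge_label_co_tree)
  show "edge_label n \<gamma> X p q = [] \<or> (\<exists>x\<in>X. \<exists>b. p = co_tree_end n \<gamma> x b \<and> q = co_tree_end n \<gamma> x (\<not> b))" for p q
    by (rule edge_label_cases)
  show "tree_walk n p \<noteq> [] \<and> hd (tree_walk n p) = hd (tree_walk n (pr n A0)) \<and> last (tree_walk n p) = p"
    if "p \<in> pr n ` codes n" for p
    using that tree_walk_props assms by auto
  show "successively tree (tree_walk n p)" if "p \<in> pr n ` codes n" for p
    using that tree_walk_props by auto
  show "(tree_walk n p @ [q], tree_walk n q) \<in> word_cong (projections n) (PG_rels (projections n) (pmult n))"
    if "adj n p q" "edge_label n \<gamma> X p q = []" for p q
    using tree_walk_step that by blast
qed

end

theorem corollary6p51:
  fixes n :: nat and p0 :: diagram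
  assumes "n \<ge> 1"
    and "p0 \<in> projections n"
    and "rank n p0 = n - 1"
  shows "free_of_rank
           (maximal_subgroup
             (PG (projections n) (pmult n))
             (PG_mult (projections n) (pmult n))
             (PG_gen (projections n) (pmult n) p0))
           ((n - 1) choose 2)"
proof -
  obtain A0 where A0: "A0 \<subseteq> {1..n}" "card A0 \<le> 2" "p0 = pr n A0"
    using projection_cases[OF assms(2)] assms(3) by (metis order_refl)
  \<comment> \<open>The identity has rank at least n, which exceeds n - 1 because
    \<open>n \<ge> 1\<close>.\<close>
  have "A0 \<noteq> {}"
    using rank_id[of n] assms(1,3) A0(3) by auto
  moreover have "finite A0" using A0(1) by (rule finite_subset) simp
  ultimately have "card A0 \<noteq> 0" by simp
  then have "A0 \<in> codes n" using A0(1,2) unfolding codes_def by auto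
  \<comment> \<open>Each pair avoiding the root point 1 accounts for one edge outside the tree;
    numbering these pairs names the free generators.\<close>
  let ?E = "{A. A \<subseteq> {2..n} \<and> card A = 2}"
  have "finite ?E" by (rule finite_subset[of _ "Pow {2..n}"]) auto
  moreover have "card ?E = (n - 1) choose 2" using n_subsets[of "{2..n}" 2] by simp
  ultimately obtain \<gamma> where \<gamma>: "bij_betw \<gamma> {..<(n - 1) choose 2} ?E"
    using ex_bij_betw_nat_finite[of ?E] by (auto simp: atLeast0LessThan)
  interpret pg_graph "projections n" "pmult n" "pr n {}" p0 "pr n ` codes n" "adj n"
    "{..<(n - 1) choose 2}" "edge_label n \<gamma> {..<(n - 1) choose 2}" "co_tree_end n \<gamma>" "tree_walk n"
    unfolding A0(3) by (rule pg_graph_codes) fact+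
  show ?thesis
    unfolding free_of_rank_def using maximal_subgroup_free group.iso_sym[OF group_free_group] by blast
qed

end
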